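(* Let $\mathbb{K}$ be a field of characteristic not $2$. Any nonzero nilpotent generalized $\mathbb{K}$-oscillator algebra $(\mathfrak{d}(V,\varphi,\delta),\varphi_\delta)$ of nilpotency index $k$ is given through a $\varphi$-skew nilpotent map $\delta$ such that $m_\delta(x)=x^k$, where $m_\delta$ is the minimal polynomial of $\delta$. Even more, the space $(V,\varphi)$ decomposes as an orthogonal sum of a finite number of $\delta$-invariant regular subspaces $(W,\varphi|_W)$, each of dimension $2n+1$ or $4m$ with $n\le\lfloor\frac12(k-1)\rfloor$ and $m\le\lfloor\frac12 k\rfloor$. And for each such $W$ there is a basis of $W$ in which the pair $(\delta|_W,\varphi|_W)$ is expressed by the following matrix pair $(A_{\delta|_W},B_{\varphi|_W})$: if $\dim W=2n+1$ is odd, $$\left(\begin{pmatrix}J_{n}(0)&0&0\\ \mathbf{e}_1&0&0\\ 0&-\mathbf{e}_1^t&-J_{n}(0)^t\end{pmatrix},\ (-1)^{n}\mu\begin{pmatrix}0&0&\mathrm{Id}_{n}\\0&1&0\\ \mathrm{Id}_{n}&0&0\end{pmatrix}\right)$$ for some $\mu\in\mathbb{K}^\times$ (with $\mathbf{e}_1=(1,0,\dots,0)\in\mathbb{K}^n$ a row vector; for $n=0$ the pair is $((0),(\mu))$); and if $\dim W=4m$, $$\left(\begin{pmatrix}J_{2m}(0)&0\\0&-J_{2m}(0)^t\end{pmatrix},\ \begin{pmatrix}0&\mathrm{Id}_{2m}\\ \mathrm{Id}_{2m}&0\end{pmatrix}\right).$$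
   Context: Generalized $\mathbb{K}$-oscillator algebra: let $V$ be a finite-dimensional $\mathbb{K}$-vector space with $\dim V\ge 2$, $\varphi$ a non-degenerate symmetric bilinear form on $V$, and $\delta\colon V\to V$ a $\varphi$-skew linear map, i.e. $\varphi(\delta(x),y)=-\varphi(x,\delta(y))$. Then $\mathfrak{d}(V,\varphi,\delta)=\mathbb{K}\cdot\delta\oplus V\oplus\mathbb{K}\cdot\delta^*$, where $\delta$ and $\delta^*$ are used as basis symbols of one-dimensional spaces (the summand $\mathbb{K}\cdot\delta$ is one-dimensional even if the map $\delta$ is zero), is the Lie algebra with bracket $$[t\delta+x+s\delta^*,t'\delta+y+s'\delta^*]=t\,\delta(y)-t'\,\delta(x)+\varphi(\delta(x),y)\,\delta^*,$$ and it carries the non-degenerate invariant symmetric bilinear form $$\varphi_\delta(t\delta+x+s\delta^*,t'\delta+y+s'\delta^* )=ts'+st'+\varphi(x,y),$$ for $t,t',s,s'\in\mathbb{K}$, $x,y\in V$. With $L^1=L$ and $L^{k+1}=[L^k,L]$, the nilpotency index of a nilpotent Lie algebra $L$ is the $k$ with $L^k\neq 0=L^{k+1}$. A subspace $W$ is regular if $W\cap W^\perp=0$. $J_n(0)$ is the $n\times n$ Jordan block with $0$ on the diagonal and $1$ on the superdiagonal. Matrices of linear maps have as columns the coordinates of the images of the basis vectors; the matrix of a bilinear form is its Gram matrix. *)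

theory Defs
  imports
    "HOL-Library.Product_Plus"
    "HOL-Library.FuncSet"
    "HOL-Computational_Algebra.Polynomial"
    "Jordan_Normal_Form.Jordan_Normal_Form"
begin

definition orth_complement :: "('v \<Rightarrow> 'v \<Rightarrow> 'k::zero) \<Rightarrow> 'v set \<Rightarrow> 'v set" where
  "orth_complement \<phi> W = {x. \<forall>w\<in>W. \<phi> x w = 0}"

definition gram_matrix :: "('v \<Rightarrow> 'v \<Rightarrow> 'k) \<Rightarrow> 'v list \<Rightarrow> 'k mat" where
  "gram_matrix \<phi> bs = mat (length bs) (length bs) (\<lambda>(i, j). \<phi> (bs ! i) (bs ! j))"

definition nilpotent_map :: "('v::zero \<Rightarrow> 'v) \<Rightarrow> bool" where
  "nilpotent_map f \<longleftrightarrow> (\<exists>j. f ^^ j = (\<lambda>_. 0))"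

context vector_space
begin

definition symmetric_bilinear_form :: "('b \<Rightarrow> 'b \<Rightarrow> 'a) \<Rightarrow> bool" where
  "symmetric_bilinear_form \<phi> \<longleftrightarrow>
    (\<forall>x. Vector_Spaces.linear scale (*) (\<phi> x)) \<and> (\<forall>x y. \<phi> x y = \<phi> y x)"

definition nondegenerate :: "('b \<Rightarrow> 'b \<Rightarrow> 'a) \<Rightarrow> bool" where
  "nondegenerate \<phi> \<longleftrightarrow> (\<forall>x. (\<forall>y. \<phi> x y = 0) \<longrightarrow> x = 0)"

definition regular_subspace :: "('b \<Rightarrow> 'b \<Rightarrow> 'a) \<Rightarrow> 'b set \<Rightarrow> bool" where
  "regular_subspace \<phi> W \<longleftrightarrow> subspace W \<and> W \<inter> orth_complement \<phi> W = {0}"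

text \<open>The extensional product makes the family of components of \<open>v\<close> unique also as a
  total function, so the last conjunct says that the sum is direct and exhausts the space.\<close>

definition orthogonal_direct_sum :: "('b \<Rightarrow> 'b \<Rightarrow> 'a) \<Rightarrow> 'i set \<Rightarrow> ('i \<Rightarrow> 'b set) \<Rightarrow> bool" where
  "orthogonal_direct_sum \<phi> I W \<longleftrightarrow>
    finite I \<and> (\<forall>i\<in>I. subspace (W i)) \<and>
    (\<forall>i\<in>I. \<forall>j\<in>I. i \<noteq> j \<longrightarrow> (\<forall>x\<in>W i. \<forall>y\<in>W j. \<phi> x y = 0)) \<and>
    (\<forall>v. \<exists>!w. w \<in> (\<Pi>\<^sub>E i\<in>I. W i) \<and> v = (\<Sum>i\<in>I. w i))"

definition ordered_basis :: "'b list \<Rightarrow> 'b set \<Rightarrow> bool" where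
  "ordered_basis bs W \<longleftrightarrow> distinct bs \<and> independent (set bs) \<and> span (set bs) = W"

text \<open>Column \<open>j\<close> holds the coordinates of the image of the \<open>j\<close>-th basis vector. This is only
  meaningful when \<open>f\<close> maps the span of \<open>bs\<close> into itself, and is then the matrix
  of the restriction of \<open>f\<close> to that span.\<close>

definition map_matrix :: "('b \<Rightarrow> 'b) \<Rightarrow> 'b list \<Rightarrow> 'a mat" where
  "map_matrix f bs = mat (length bs) (length bs)
     (\<lambda>(i, j). representation (set bs) (f (bs ! j)) (bs ! i))"

definition poly_map :: "'a poly \<Rightarrow> ('b \<Rightarrow> 'b) \<Rightarrow> 'b \<Rightarrow> 'b" where
  "poly_map p f v = (\<Sum>i\<le>degree p. scale (coeff p i) ((f ^^ i) v))"

text \<open>The monic generator of the ideal of polynomials annihilating \<open>f\<close>.\<close>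

definition minimal_polynomial :: "('b \<Rightarrow> 'b) \<Rightarrow> 'a poly" where
  "minimal_polynomial f = (THE p. lead_coeff p = 1 \<and>
     (\<forall>q. local.poly_map q f = (\<lambda>_. 0) \<longleftrightarrow> p dvd q))"

end

locale lie_algebra = vector_space scale
  for scale :: "'a::field \<Rightarrow> 'b::ab_group_add \<Rightarrow> 'b" +
  fixes bracket :: "'b \<Rightarrow> 'b \<Rightarrow> 'b"
  assumes bracket_linear_left: "Vector_Spaces.linear scale scale (\<lambda>x. bracket x y)"
    and bracket_linear_right: "Vector_Spaces.linear scale scale (bracket x)"
    and bracket_alternating: "bracket x x = 0"
    and jacobi: "bracket x (bracket y z) + bracket y (bracket z x) + bracket z (bracket x y) = 0"
begin

text \<open>The lower central series starts with \<open>L\<^sup>1 = L\<close>; the value at \<open>0\<close> is a dummy.\<close>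

fun lower_central_series :: "nat \<Rightarrow> 'b set" where
  "lower_central_series 0 = UNIV"
| "lower_central_series (Suc 0) = UNIV"
| "lower_central_series (Suc (Suc k)) =
     span {bracket x y | x y. x \<in> lower_central_series (Suc k)}"

definition nilpotent_of_index :: "nat \<Rightarrow> bool" where
  "nilpotent_of_index k \<longleftrightarrow> 1 \<le> k \<and>
     lower_central_series k \<noteq> {0} \<and> lower_central_series (k + 1) = {0}"

end

text \<open>The element \<open>t \<delta> + x + s \<delta>\<^sup>*\<close> is encoded as the triple \<open>(t, x, s)\<close>.\<close>

type_synonym ('k, 'v) osc = "'k \<times> 'v \<times> 'k"

fun osc_scale :: "('k::field \<Rightarrow> 'v \<Rightarrow> 'v) \<Rightarrow> 'k \<Rightarrow> ('k, 'v) osc \<Rightarrow> ('k, 'v) osc" where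
  "osc_scale scale c (t, x, s) = (c * t, scale c x, c * s)"

fun osc_bracket :: "('k::field \<Rightarrow> 'v::ab_group_add \<Rightarrow> 'v) \<Rightarrow> ('v \<Rightarrow> 'v \<Rightarrow> 'k) \<Rightarrow> ('v \<Rightarrow> 'v) \<Rightarrow>
    ('k, 'v) osc \<Rightarrow> ('k, 'v) osc \<Rightarrow> ('k, 'v) osc" where
  "osc_bracket scale \<phi> \<delta> (t, x, s) (t', y, s') =
     (0, scale t (\<delta> y) - scale t' (\<delta> x), \<phi> (\<delta> x) y)"

fun osc_form :: "('v \<Rightarrow> 'v \<Rightarrow> 'k::field) \<Rightarrow> ('k, 'v) osc \<Rightarrow> ('k, 'v) osc \<Rightarrow> 'k" where
  "osc_form \<phi> (t, x, s) (t', y, s') = t * s' + s * t' + \<phi> x y"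

locale generalized_oscillator = finite_dimensional_vector_space scale Basis
  for scale :: "'a::field \<Rightarrow> 'b::ab_group_add \<Rightarrow> 'b" and Basis :: "'b set" +
  fixes \<phi> :: "'b \<Rightarrow> 'b \<Rightarrow> 'a" and \<delta> :: "'b \<Rightarrow> 'b"
  assumes dim_ge_2: "2 \<le> dim UNIV"
    and form: "symmetric_bilinear_form \<phi>" "nondegenerate \<phi>"
    and linear_delta: "Vector_Spaces.linear scale scale \<delta>"
    and skew: "\<phi> (\<delta> x) y = - \<phi> x (\<delta> y)"
begin

lemma phi_sym: "\<phi> x y = \<phi> y x"
  using form by (auto simp: symmetric_bilinear_form_def)

lemma phi_right [simp]:
  "\<phi> x (y + z) = \<phi> x y + \<phi> x z" "\<phi> x (scale c y) = c * \<phi> x y"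
  "\<phi> x (y - z) = \<phi> x y - \<phi> x z" "\<phi> x (- y) = - \<phi> x y" "\<phi> x 0 = 0"
proof -
  interpret p: Vector_Spaces.linear scale "(*)" "\<phi> x"
    using form by (auto simp: symmetric_bilinear_form_def)
  show "\<phi> x (y + z) = \<phi> x y + \<phi> x z" "\<phi> x (scale c y) = c * \<phi> x y"
    "\<phi> x (y - z) = \<phi> x y - \<phi> x z" "\<phi> x (- y) = - \<phi> x y" "\<phi> x 0 = 0"
    by (rule p.add p.scale p.diff p.neg p.zero)+
qed

lemma phi_left [simp]:
  "\<phi> (y + z) x = \<phi> y x + \<phi> z x" "\<phi> (scale c y) x = c * \<phi> y x"
  "\<phi> (y - z) x = \<phi> y x - \<phi> z x" "\<phi> (- y) x = - \<phi> y x" "\<phi> 0 x = 0"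
  by (simp_all add: phi_sym[of _ x])

lemma delta_linear [simp]:
  "\<delta> (y + z) = \<delta> y + \<delta> z" "\<delta> (scale c y) = scale c (\<delta> y)"
  "\<delta> (y - z) = \<delta> y - \<delta> z" "\<delta> (- y) = - \<delta> y" "\<delta> 0 = 0"
proof -
  interpret d: Vector_Spaces.linear scale scale \<delta> by (rule linear_delta)
  show "\<delta> (y + z) = \<delta> y + \<delta> z" "\<delta> (scale c y) = scale c (\<delta> y)"
    "\<delta> (y - z) = \<delta> y - \<delta> z" "\<delta> (- y) = - \<delta> y" "\<delta> 0 = 0"
    by (rule d.add d.scale d.diff d.neg d.zero)+
qed

lemma osc_vector_space: "vector_space (osc_scale scale)"
  by unfold_locales (auto simp: algebra_simps)

text \<open>Only the alternating law needs the characteristic to differ from 2.\<close>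

lemma osc_lie_algebra:
  assumes "CHAR('a) \<noteq> 2"
  shows "lie_algebra (osc_scale scale) (osc_bracket scale \<phi> \<delta>)"
proof -
  have two: "(2::'a) \<noteq> 0"
  proof
    assume "(2::'a) = 0"
    then have "of_nat 2 = (0::'a)" by simp
    then have "CHAR('a) dvd 2" by (simp only: of_nat_eq_0_iff_char_dvd)
    then have "CHAR('a) = 1 \<or> CHAR('a) = 2"
      by (metis prime_nat_iff two_is_prime_nat)
    with assms show False by simp
  qed
  have alt: "\<phi> (\<delta> x) x = 0" for x
  proof -
    have "\<phi> (\<delta> x) x = - \<phi> (\<delta> x) x" using skew[of x x] phi_sym by metis
    then have "2 * \<phi> (\<delta> x) x = 0" by (metis mult_2 add.right_inverse)
    with two show ?thesis by simp
  qed
  interpret o: vector_space "osc_scale scale" by (rule osc_vector_space)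
  have jac: "osc_bracket scale \<phi> \<delta> u (osc_bracket scale \<phi> \<delta> v w)
      + osc_bracket scale \<phi> \<delta> v (osc_bracket scale \<phi> \<delta> w u)
      + osc_bracket scale \<phi> \<delta> w (osc_bracket scale \<phi> \<delta> u v) = 0" for u v w
  proof -
    obtain t x s t' y s' t'' z s'' where
      "u = (t, x, s)" "v = (t', y, s')" "w = (t'', z, s'')"
      by (metis prod.exhaust)
    moreover have "\<phi> (\<delta> y) (\<delta> x) = \<phi> (\<delta> x) (\<delta> y)" "\<phi> (\<delta> z) (\<delta> x) = \<phi> (\<delta> x) (\<delta> z)"
      "\<phi> (\<delta> z) (\<delta> y) = \<phi> (\<delta> y) (\<delta> z)" by (rule phi_sym)+
    ultimately show ?thesis
      by (simp add: algebra_simps zero_prod_def)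
  qed
  show ?thesis
    by unfold_locales
      (rule jac | (auto simp: alt algebra_simps zero_prod_def; fail))+
qed

lemma osc_form_symmetric_bilinear:
  "vector_space.symmetric_bilinear_form (osc_scale scale) (osc_form \<phi>)"
proof -
  interpret o: vector_space "osc_scale scale" by (rule osc_vector_space)
  have "Vector_Spaces.linear (osc_scale scale) (*) (osc_form \<phi> u)" for u
    by (cases u) (unfold_locales, auto simp: algebra_simps)
  moreover have "osc_form \<phi> u v = osc_form \<phi> v u" for u v
    by (cases u; cases v) (simp, metis add.commute mult.commute phi_sym)
  ultimately show ?thesis by (auto simp: o.symmetric_bilinear_form_def)
qed

lemma osc_form_nondegenerate: "vector_space.nondegenerate (osc_form \<phi>)"
proof -
  interpret o: vector_space "osc_scale scale" by (rule osc_vector_space)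
  have "u = 0" if *: "\<And>v. osc_form \<phi> u v = 0" for u
  proof -
    obtain t x s where u: "u = (t, x, s)" by (metis prod.exhaust)
    have "t = 0" using *[of "(0, 0, 1)"] u by simp
    moreover have "s = 0" using *[of "(1, 0, 0)"] u by simp
    moreover have "\<phi> x y = 0" for y using *[of "(0, y, 0)"] u by simp
    ultimately show ?thesis using form(2) u by (auto simp: nondegenerate_def zero_prod_def)
  qed
  then show ?thesis by (auto simp: o.nondegenerate_def)
qed

lemma osc_form_invariant:
  "osc_form \<phi> (osc_bracket scale \<phi> \<delta> u v) w = osc_form \<phi> u (osc_bracket scale \<phi> \<delta> v w)"
proof -
  obtain t x s t' y s' t'' z s'' where
    "u = (t, x, s)" "v = (t', y, s')" "w = (t'', z, s'')"
    by (metis prod.exhaust)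
  moreover have "\<phi> (\<delta> y) z = - \<phi> y (\<delta> z)" "\<phi> (\<delta> x) y = - \<phi> x (\<delta> y)"
      "\<phi> (\<delta> x) z = - \<phi> x (\<delta> z)"
    by (rule skew)+
  moreover have "\<phi> (\<delta> y) z = \<phi> z (\<delta> y)" by (rule phi_sym)
  ultimately show ?thesis by (simp add: algebra_simps)
qed

end

definition three_block_mat ::
  "'a::zero mat \<Rightarrow> 'a mat \<Rightarrow> 'a mat \<Rightarrow> 'a mat \<Rightarrow> 'a mat \<Rightarrow> 'a mat \<Rightarrow> 'a mat \<Rightarrow> 'a mat \<Rightarrow> 'a mat \<Rightarrow> 'a mat"
where
  "three_block_mat A B C D E F G H I =
     four_block_mat A (four_block_mat B C (0\<^sub>m 0 (dim_col B)) (0\<^sub>m 0 (dim_col C)))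
       (D @\<^sub>r G) (four_block_mat E F H I)"

text \<open>For \<open>n = 0\<close> this is the empty \<open>1 \<times> 0\<close> matrix, so that the odd pair below
  degenerates to the \<open>1 \<times> 1\<close> matrices \<open>(0)\<close> and \<open>(\<mu>)\<close>.\<close>

definition e1_row :: "nat \<Rightarrow> 'k::field mat" where
  "e1_row n = mat_of_row (unit_vec n 0)"

definition odd_map_matrix :: "nat \<Rightarrow> 'k::field mat" where
  "odd_map_matrix n = three_block_mat
     (jordan_block n 0)  (0\<^sub>m n 1)                  (0\<^sub>m n n)
     (e1_row n)          (0\<^sub>m 1 1)                  (0\<^sub>m 1 n)
     (0\<^sub>m n n)            (- transpose_mat (e1_row n))  (- transpose_mat (jordan_block n 0))"

definition odd_form_matrix :: "nat \<Rightarrow> 'k::field \<Rightarrow> 'k mat" where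
  "odd_form_matrix n \<mu> = ((- 1) ^ n * \<mu>) \<cdot>\<^sub>m three_block_mat
     (0\<^sub>m n n)  (0\<^sub>m n 1)  (1\<^sub>m n)
     (0\<^sub>m 1 n)  (1\<^sub>m 1)    (0\<^sub>m 1 n)
     (1\<^sub>m n)    (0\<^sub>m n 1)  (0\<^sub>m n n)"

definition even_map_matrix :: "nat \<Rightarrow> 'k::field mat" where
  "even_map_matrix m = four_block_mat
     (jordan_block (2 * m) 0)  (0\<^sub>m (2 * m) (2 * m))
     (0\<^sub>m (2 * m) (2 * m))      (- transpose_mat (jordan_block (2 * m) 0))"

definition even_form_matrix :: "nat \<Rightarrow> 'k::field mat" where
  "even_form_matrix m = four_block_mat
     (0\<^sub>m (2 * m) (2 * m))  (1\<^sub>m (2 * m))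
     (1\<^sub>m (2 * m))          (0\<^sub>m (2 * m) (2 * m))"

end

theory Submission
  imports Defs
begin

text \<open>
  In the oscillator algebra the generator \<open>\<delta>\<close> acts on \<open>V\<close> as the map \<open>\<delta>\<close>, and brackets of vectors
  fall into the centre. Hence the \<open>(j+1)\<close>-st term of the lower central series vanishes exactly when
  the \<open>j\<close>-th power of \<open>\<delta>\<close> does (\<open>lower_central_series_zero_iff\<close>). So nilpotency index \<open>k\<close> means
  that \<open>k\<close> is the least exponent with \<open>\<delta>\<^sup>k = 0\<close>, and the minimal polynomial is \<open>x\<^sup>k\<close>.

  The rest is linear algebra of a nilpotent skew map on a nondegenerate space. On a nonzero invariant
  regular subspace let \<open>\<delta>\<^sup>N\<close> be the last nonvanishing power of \<open>\<delta>\<close>. The bilinear form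
  \<open>\<phi> x (\<delta>\<^sup>N y)\<close> is nonzero, and it is symmetric or alternating according to the parity of \<open>N\<close>.
  In the symmetric case, since the characteristic is not \<open>2\<close>, some vector has a nonzero value on the
  diagonal, and its chain of \<open>N + 1 = 2n + 1\<close> vectors is the odd block.
  In the alternating case one takes two vectors that pair to a nonzero value, and their two chains of
  length \<open>N + 1 = 2m\<close> are the even block. The generators have first to be corrected by elements
  of higher order so that all lower pairings \<open>\<phi> x (\<delta>\<^sup>j y)\<close>, \<open>j < N\<close>, vanish
  (\<open>isotropic_correction\<close>, \<open>pairing_correction\<close>). After that the Gram matrix of the chains is
  a multiple of the permutation matrix of an involution. This shows at once that the chains are a basis of
  a regular subspace with an orthogonal projection onto it (\<open>involutive_gram_basis\<close>), which
  makes it possible to pass to the orthogonal complement and to proceed by induction on the dimension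
  (\<open>orthogonal_block_decomposition\<close>). As \<open>N < k\<close>, the block sizes are bounded as claimed.
\<close>

section \<open>Powers of a skew map\<close>

context generalized_oscillator
begin

lemma phi_sum_left: "\<phi> (\<Sum>i\<in>I. f i) y = (\<Sum>i\<in>I. \<phi> (f i) y)"
  by (induction I rule: infinite_finite_induct) simp_all

lemma delta_pow_linear [simp]:
  "(\<delta> ^^ i) (x + y) = (\<delta> ^^ i) x + (\<delta> ^^ i) y"
  "(\<delta> ^^ i) (x - y) = (\<delta> ^^ i) x - (\<delta> ^^ i) y"
  "(\<delta> ^^ i) (scale c x) = scale c ((\<delta> ^^ i) x)"
  "(\<delta> ^^ i) 0 = 0"
  "(\<delta> ^^ i) (- x) = - (\<delta> ^^ i) x"
  by (induction i) simp_all

lemma delta_pow_pow [simp]: "(\<delta> ^^ i) ((\<delta> ^^ j) x) = (\<delta> ^^ (i + j)) x"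
  by (simp add: funpow_add)

lemma delta_pow_in:
  assumes "\<delta> ` U \<subseteq> U" and "x \<in> U"
  shows "(\<delta> ^^ i) x \<in> U"
  using assms by (induction i) auto

lemma delta_pow_vanish:
  assumes "(\<delta> ^^ i) x = 0" and "i \<le> j"
  shows "(\<delta> ^^ j) x = 0"
  using assms delta_pow_pow[of "j - i" i x] by simp

lemma skew_pow: "\<phi> ((\<delta> ^^ i) x) y = (- 1) ^ i * \<phi> x ((\<delta> ^^ i) y)"
proof (induction i arbitrary: y)
  case (Suc i)
  have "\<phi> ((\<delta> ^^ Suc i) x) y = - \<phi> ((\<delta> ^^ i) x) (\<delta> y)" by (simp add: skew)
  also have "\<dots> = (- 1) ^ Suc i * \<phi> x ((\<delta> ^^ Suc i) y)"
    using Suc[of "\<delta> y"] by (simp add: funpow_swap1)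
  finally show ?case .
qed simp

text \<open>The form \<open>(x, y) \<mapsto> \<phi> x (\<delta>\<^sup>i y)\<close> is symmetric for even \<open>i\<close> and alternating for odd \<open>i\<close>; this sign
  is the source of the two kinds of blocks.\<close>

lemma skew_pow_flip: "\<phi> x ((\<delta> ^^ i) y) = (- 1) ^ i * \<phi> y ((\<delta> ^^ i) x)"
  using skew_pow[of i y x] by (simp add: phi_sym)

lemma odd_pow_isotropic:
  assumes "(2::'a) \<noteq> 0" and "odd i"
  shows "\<phi> x ((\<delta> ^^ i) x) = 0"
proof -
  have "\<phi> x ((\<delta> ^^ i) x) = - \<phi> x ((\<delta> ^^ i) x)"
    using skew_pow_flip[of x i x] \<open>odd i\<close> by simp
  then have "2 * \<phi> x ((\<delta> ^^ i) x) = 0" by (metis mult_2 add.right_inverse)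
  with assms(1) show ?thesis by simp
qed

section \<open>Nilpotency index and minimal polynomial\<close>

text \<open>Write \<open>L\<close> for the oscillator algebra. The bracket with the generator \<open>\<delta>\<close> applies the map
  \<open>\<delta>\<close> once more, so \<open>L\<^sup>j\<^sup>+\<^sup>1\<close> contains \<open>\<delta>\<^sup>j V\<close>; conversely the \<open>V\<close>-components of its elements lie
  in \<open>\<delta>\<^sup>j V\<close>. What remains is the central line \<open>\<bbbK>\<delta>\<^sup>*\<close>: its coefficient in a bracket with
  \<open>t\<delta> + x + s\<delta>\<^sup>*\<close> is a value of \<open>\<phi> (\<delta> x)\<close>, so it disappears together with \<open>\<delta>\<^sup>j V\<close>. For \<open>j = 0\<close> both
  sides are false because \<open>V\<close> is nonzero.\<close>

lemma lower_central_series_zero_iff: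
  assumes "CHAR('a) \<noteq> 2"
  shows "lie_algebra.lower_central_series (osc_scale scale) (osc_bracket scale \<phi> \<delta>) (Suc j) = {0}
    \<longleftrightarrow> \<delta> ^^ j = (\<lambda>_. 0)"
proof -
  interpret L: lie_algebra "osc_scale scale" "osc_bracket scale \<phi> \<delta>"
    using assms by (rule osc_lie_algebra)
  have lower: "(0, (\<delta> ^^ j) y, 0) \<in> L.lower_central_series (Suc j)" for j y
  proof (induction j)
    case (Suc j)
    \<comment> \<open>The bracket with \<open>-\<delta>\<close>; the sign is due to \<open>\<delta>\<close> standing on the right.\<close>
    have "(0, (\<delta> ^^ Suc j) y, 0) = osc_bracket scale \<phi> \<delta> (0, (\<delta> ^^ j) y, 0) (- 1, 0, 0)"
      by simp
    with Suc show ?case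
      unfolding L.lower_central_series.simps by (intro L.span_base) blast
  qed simp
  have upper: "L.lower_central_series (Suc j) \<subseteq> {(t, x, s). x \<in> range (\<delta> ^^ j) \<and> (j \<noteq> 0 \<longrightarrow> t = 0)}" for j
  proof (induction j)
    case (Suc j)
    have "\<exists>z. scale t (\<delta> y) - scale t' (\<delta> x) = (\<delta> ^^ Suc j) z"
      if x: "x = (\<delta> ^^ j) u" and t: "j \<noteq> 0 \<longrightarrow> t = 0" for t x t' y u
    proof (cases "j = 0")
      case True
      with x show ?thesis by (intro exI[of _ "scale t y - scale t' x"]) simp
    next
      case False
      with x t show ?thesis by (intro exI[of _ "scale (- t') u"]) simp
    qed
    note image = this
    have gen: "{osc_bracket scale \<phi> \<delta> p q | p q. p \<in> L.lower_central_series (Suc j)}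
        \<subseteq> {(t, x, s). x \<in> range (\<delta> ^^ Suc j) \<and> t = 0}"
    proof
      fix l assume "l \<in> {osc_bracket scale \<phi> \<delta> p q | p q. p \<in> L.lower_central_series (Suc j)}"
      then obtain p q where l: "l = osc_bracket scale \<phi> \<delta> p q" "p \<in> L.lower_central_series (Suc j)"
        by blast
      obtain t x s where p: "p = (t, x, s)" by (cases p)
      obtain t' y s' where q: "q = (t', y, s')" by (cases q)
      from Suc l(2) obtain u where "x = (\<delta> ^^ j) u" "j \<noteq> 0 \<longrightarrow> t = 0" unfolding p by blast
      from image[OF this, of y t'] show "l \<in> {(t, x, s). x \<in> range (\<delta> ^^ Suc j) \<and> t = 0}"
        unfolding l p q by (simp add: image_iff del: funpow.simps)
    qed
    have "L.subspace {(t, x, s). x \<in> range (\<delta> ^^ Suc j) \<and> t = 0}" (is "L.subspace ?M")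
    proof (rule L.subspaceI)
      show "0 \<in> ?M"
        by (auto simp: zero_prod_def image_iff simp del: funpow.simps intro!: exI[of _ 0])
    next
      fix p q :: "('a, 'b) osc" assume "p \<in> ?M" "q \<in> ?M"
      then show "p + q \<in> ?M"
        by (auto simp del: funpow.simps delta_pow_linear simp flip: delta_pow_linear(1))
    next
      fix c and p :: "('a, 'b) osc" assume "p \<in> ?M"
      then show "osc_scale scale c p \<in> ?M"
        by (auto simp del: funpow.simps delta_pow_linear simp flip: delta_pow_linear(3))
    qed
    with gen have "L.span {osc_bracket scale \<phi> \<delta> p q | p q. p \<in> L.lower_central_series (Suc j)}
        \<subseteq> {(t, x, s). x \<in> range (\<delta> ^^ Suc j) \<and> t = 0}"
      by (rule L.span_minimal)
    then show ?case by auto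
  qed auto
  show ?thesis
  proof
    assume zero: "L.lower_central_series (Suc j) = {0}"
    show "\<delta> ^^ j = (\<lambda>_. 0)"
    proof
      fix y show "(\<delta> ^^ j) y = 0" using lower[of j y] zero by (simp add: zero_prod_def)
    qed
  next
    assume zero: "\<delta> ^^ j = (\<lambda>_. 0)"
    show "L.lower_central_series (Suc j) = {0}"
    proof (cases j)
      case 0
      have "(UNIV :: 'b set) \<subseteq> span {}"
      proof
        fix x :: 'b
        have "x = 0" using fun_cong[OF zero, of x] 0 by simp
        then show "x \<in> span {}" by (simp only: span_zero)
      qed
      then have "dim UNIV \<le> card ({} :: 'b set)" by (rule dim_le_card) simp
      then show ?thesis using dim_ge_2 by simp
    next
      case (Suc i)
      have x0: "t = 0 \<and> \<delta> x = 0 \<or> i = 0 \<and> \<delta> = (\<lambda>_. 0)"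
        if "(t, x, s) \<in> L.lower_central_series (Suc i)" for t x s
        using upper[of i] that zero fun_cong[OF zero] Suc by (cases i) (auto simp: fun_eq_iff)
      have "osc_bracket scale \<phi> \<delta> p q = 0" if p: "p \<in> L.lower_central_series (Suc i)" for p q
      proof -
        obtain t x s where p': "p = (t, x, s)" by (cases p)
        obtain t' y s' where q': "q = (t', y, s')" by (cases q)
        from p have "(t, x, s) \<in> L.lower_central_series (Suc i)" unfolding p' .
        from x0[OF this] show ?thesis unfolding p' q' by (auto simp: zero_prod_def)
      qed
      then have "{osc_bracket scale \<phi> \<delta> p q | p q. p \<in> L.lower_central_series (Suc i)} \<subseteq> {0}"
        by auto
      then have "L.lower_central_series (Suc (Suc i)) \<subseteq> {0}"
        unfolding L.lower_central_series.simps by (intro L.span_minimal) auto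
      then show ?thesis using Suc L.span_zero by auto
    qed
  qed
qed

end

context vector_space
begin

text \<open>If \<open>q\<close> annihilates \<open>f\<close> and \<open>c\<close> is its coefficient of least degree \<open>i < k\<close>, then applying
  \<open>f\<^sup>k\<^sup>-\<^sup>1\<^sup>-\<^sup>i\<close> to \<open>q(f) = 0\<close> leaves only \<open>c f\<^sup>k\<^sup>-\<^sup>1 = 0\<close>,
  although \<open>f\<^sup>k\<^sup>-\<^sup>1\<close> is nonzero.\<close>

lemma minimal_polynomial_nilpotent:
  assumes f: "Vector_Spaces.linear scale scale f"
    and zero: "f ^^ k = (\<lambda>_. 0)" and nonzero: "\<And>i. i < k \<Longrightarrow> f ^^ i \<noteq> (\<lambda>_. 0)"
  shows "minimal_polynomial f = monom 1 k"
proof -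
  interpret f: Vector_Spaces.linear scale scale f by (rule f)
  have pow0: "(f ^^ i) 0 = 0" for i by (induction i) (simp_all add: f.zero)
  have pow_sum: "(f ^^ j) (\<Sum>i\<in>I. scale (c i) (g i)) = (\<Sum>i\<in>I. scale (c i) ((f ^^ j) (g i)))"
    for j and I :: "nat set" and c g
    by (induction j) (simp_all add: f.sum f.scale)
  have vanish: "(f ^^ i) v = 0" if "k \<le> i" for i v
    using that zero pow0 by (metis add_diff_inverse_nat comp_apply funpow_add add.commute linorder_not_less)
  have ideal: "local.poly_map q f = (\<lambda>_. 0) \<longleftrightarrow> monom 1 k dvd q" for q
  proof
    assume q: "local.poly_map q f = (\<lambda>_. 0)"
    have "coeff q i = 0" if "i < k" for i
      using that
    proof (induction i rule: less_induct)
      case (less i)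
      obtain v where v: "(f ^^ (k - 1)) v \<noteq> 0"
        using nonzero[of "k - 1"] less.prems by (auto simp: fun_eq_iff)
      show ?case
      proof (cases "i \<le> degree q")
        case True
        have "0 = (f ^^ (k - 1 - i)) (local.poly_map q f v)" by (simp add: q pow0)
        also have "\<dots> = (\<Sum>l\<le>degree q. scale (coeff q l) ((f ^^ (k - 1 - i + l)) v))"
          by (simp add: poly_map_def pow_sum funpow_add)
        also have "\<dots> = (\<Sum>l\<le>degree q. if l = i then scale (coeff q i) ((f ^^ (k - 1)) v) else 0)"
        proof (rule sum.cong[OF refl])
          fix l
          show "scale (coeff q l) ((f ^^ (k - 1 - i + l)) v) =
              (if l = i then scale (coeff q i) ((f ^^ (k - 1)) v) else 0)"
            using less vanish by (cases l i rule: linorder_cases) auto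
        qed
        also have "\<dots> = scale (coeff q i) ((f ^^ (k - 1)) v)" using True by simp
        finally show ?thesis using v by simp
      qed (simp add: coeff_eq_0)
    qed
    then show "monom 1 k dvd q" by (simp add: monom_1_dvd_iff')
  next
    assume "monom 1 k dvd q"
    then have low: "coeff q i = 0" if "i < k" for i using that by (simp add: monom_1_dvd_iff')
    show "local.poly_map q f = (\<lambda>_. 0)"
    proof
      fix v
      have "scale (coeff q i) ((f ^^ i) v) = 0" for i
        using low vanish by (cases "i < k") auto
      then show "local.poly_map q f v = 0" unfolding poly_map_def by (intro sum.neutral ballI)
    qed
  qed
  show ?thesis
    unfolding minimal_polynomial_def
  proof (rule the_equality)
    show "lead_coeff (monom 1 k) = (1::'a) \<and>
        (\<forall>q. local.poly_map q f = (\<lambda>_. 0) \<longleftrightarrow> monom 1 k dvd q)"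
      using ideal lead_coeff_monom[of "1 :: 'a" k] by blast
  next
    fix p :: "'a poly"
    assume p: "lead_coeff p = 1 \<and> (\<forall>q. local.poly_map q f = (\<lambda>_. 0) \<longleftrightarrow> p dvd q)"
    then have monic: "lead_coeff p = 1" and gen: "local.poly_map q f = (\<lambda>_. 0) \<longleftrightarrow> p dvd q" for q
      by (rule conjunct1, rule conjunct2[THEN spec])
    have "p dvd monom 1 k" using gen[of "monom 1 k"] ideal[of "monom 1 k"] by (simp only: dvd_refl)
    moreover have "monom 1 k dvd p" using gen[of p] ideal[of p] by (simp only: dvd_refl)
    moreover have "lead_coeff p = lead_coeff (monom 1 k)" using monic by (simp add: degree_monom_eq)
    ultimately show "p = monom 1 k" using poly_dvd_antisym by blast
  qed
qed

end

section \<open>Entries of the standard matrices\<close>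

text \<open>Every column of the standard matrices has at most one nonzero entry; these formulas say which, in
  the form that matches the action of \<open>\<delta>\<close> on the chains below.\<close>

lemma odd_map_matrix_index:
  assumes "i < 2 * n + 1" "j < 2 * n + 1"
  shows "odd_map_matrix n $$ (i, j) =
    (if j < n then if i = (if j = 0 then n else j - 1) then 1 else 0
     else if i = Suc j then - 1 else (0::'k::field))"
  using assms
  by (cases i n rule: linorder_cases; cases j n rule: linorder_cases)
    (simp_all add: odd_map_matrix_def three_block_mat_def append_rows_def e1_row_def
      jordan_block_def mat_of_row_def unit_vec_def, linarith+)

lemma odd_form_matrix_index:
  assumes "i < 2 * n + 1" "j < 2 * n + 1"
  shows "odd_form_matrix n \<mu> $$ (i, j) =
    (if j = (if i < n then i + n + 1 else if i = n then n else i - n - 1)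
     then (- 1) ^ n * \<mu> else (0::'k::field))"
  using assms
  by (cases i n rule: linorder_cases; cases j n rule: linorder_cases)
    (simp_all add: odd_form_matrix_def three_block_mat_def append_rows_def)

lemma odd_matrix_dims [simp]:
  "dim_row (odd_map_matrix n) = 2 * n + 1" "dim_col (odd_map_matrix n) = 2 * n + 1"
  "dim_row (odd_form_matrix n \<mu>) = 2 * n + 1" "dim_col (odd_form_matrix n \<mu>) = 2 * n + 1"
  by (auto simp: odd_map_matrix_def odd_form_matrix_def three_block_mat_def append_rows_def e1_row_def)

lemma even_map_matrix_index:
  assumes "i < 4 * m" "j < 4 * m"
  shows "even_map_matrix m $$ (i, j) =
    (if j < 2 * m then if j = Suc i then 1 else 0
     else if i = Suc j then - 1 else (0::'k::field))"
  using assms by (cases "i < 2 * m"; cases "j < 2 * m") (auto simp: even_map_matrix_def jordan_block_def)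

lemma even_form_matrix_index:
  assumes "i < 4 * m" "j < 4 * m"
  shows "even_form_matrix m $$ (i, j) =
    (if j = (if i < 2 * m then i + 2 * m else i - 2 * m) then 1 else (0::'k::field))"
  using assms by (cases "i < 2 * m"; cases "j < 2 * m") (auto simp: even_form_matrix_def)

lemma even_matrix_dims [simp]:
  "dim_row (even_map_matrix m) = 4 * m" "dim_col (even_map_matrix m) = 4 * m"
  "dim_row (even_form_matrix m) = 4 * m" "dim_col (even_form_matrix m) = 4 * m"
  by (auto simp: even_map_matrix_def even_form_matrix_def)

section \<open>Chains as bases of regular subspaces\<close>

context generalized_oscillator
begin

text \<open>If the Gram matrix of a list is a nonzero multiple of the permutation matrix of an involution
  \<open>\<sigma>\<close>, then \<open>bs ! \<sigma> i\<close> is up to a factor dual to \<open>bs ! i\<close>. The dual vectors read off coordinates,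
  which gives independence, regularity of the span and an explicit orthogonal projection onto it.
  Both standard Gram matrices have this form.\<close>

lemma involutive_gram_basis:
  assumes gram: "\<And>i j. i < length bs \<Longrightarrow> j < length bs \<Longrightarrow>
      \<phi> (bs ! i) (bs ! j) = (if j = \<sigma> i then s else 0)"
    and \<sigma>: "\<And>i. i < length bs \<Longrightarrow> \<sigma> i < length bs" "\<And>i. i < length bs \<Longrightarrow> \<sigma> (\<sigma> i) = i"
    and s: "s \<noteq> 0"
  shows "distinct bs" and "independent (set bs)"
    and "regular_subspace \<phi> (span (set bs))"
    and "\<exists>b\<in>span (set bs). x - b \<in> orth_complement \<phi> (span (set bs))"
proof -
  have inj: "i = j" if "i < length bs" "j < length bs" "\<sigma> i = \<sigma> j" for i j
    using \<sigma>(2) that by metis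
  have dual: "\<phi> (bs ! j) (bs ! \<sigma> i) = (if i = j then s else 0)"
    if "i < length bs" "j < length bs" for i j
    using gram[of j "\<sigma> i"] inj[of i j] \<sigma>(1) that by auto
  show distinct: "distinct bs"
    unfolding distinct_conv_nth
  proof (intro allI impI notI)
    fix i j assume "i < length bs" "j < length bs" "i \<noteq> j" "bs ! i = bs ! j"
    then show False using dual[of i j] dual[of i i] s by simp
  qed
  show "independent (set bs)"
    unfolding dependent_def
  proof (intro notI)
    assume "\<exists>a\<in>set bs. a \<in> span (set bs - {a})"
    then obtain i where i: "i < length bs" "bs ! i \<in> span (set bs - {bs ! i})"
      by (auto simp: in_set_conv_nth)
    \<comment> \<open>Pairing with \<open>bs ! \<sigma> i\<close> kills every other member of the list, hence also \<open>bs ! i\<close>.\<close>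
    have "\<phi> (bs ! i) (bs ! \<sigma> i) = 0"
    proof (rule span_induct[OF i(2)])
      show "subspace {y. \<phi> y (bs ! \<sigma> i) = 0}" by (rule subspaceI) auto
      show "\<phi> y (bs ! \<sigma> i) = 0" if "y \<in> set bs - {bs ! i}" for y
        using that dual[OF i(1)] by (auto simp: in_set_conv_nth)
    qed
    with dual[OF i(1) i(1)] s show False by simp
  qed
  \<comment> \<open>The orthogonal projection onto the span, by its coordinates.\<close>
  define p where "p y = (\<Sum>i<length bs. scale (\<phi> y (bs ! \<sigma> i) / s) (bs ! i))" for y
  have p_span: "p y \<in> span (set bs)" for y
    unfolding p_def by (intro span_sum span_scale span_base) simp
  have p_dual: "\<phi> (p y) (bs ! \<sigma> l) = \<phi> y (bs ! \<sigma> l)" if "l < length bs" for y l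
  proof -
    have "\<phi> (p y) (bs ! \<sigma> l) = (\<Sum>i<length bs. if l = i then \<phi> y (bs ! \<sigma> i) else 0)"
      unfolding p_def phi_sum_left using dual that s by (intro sum.cong) auto
    with that show ?thesis by simp
  qed
  have p_perp: "y - p y \<in> orth_complement \<phi> (span (set bs))" for y
    unfolding orth_complement_def
  proof (intro CollectI ballI)
    fix z assume "z \<in> span (set bs)"
    then show "\<phi> (y - p y) z = 0"
    proof (rule span_induct)
      show "subspace {z. \<phi> (y - p y) z = 0}" by (rule subspaceI) auto
      show "\<phi> (y - p y) z = 0" if "z \<in> set bs" for z
      proof -
        from that obtain i where i: "i < length bs" "z = bs ! i" by (metis in_set_conv_nth)
        then have "z = bs ! \<sigma> (\<sigma> i)" using \<sigma>(2) by simp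
        then show ?thesis using p_dual[of "\<sigma> i" y] \<sigma>(1)[OF i(1)] by simp
      qed
    qed
  qed
  show "\<exists>b\<in>span (set bs). x - b \<in> orth_complement \<phi> (span (set bs))"
    using p_span p_perp by blast
  have p_id: "p y = y" if "y \<in> span (set bs)" for y
    using that
  proof (rule span_induct)
    have "p 0 = 0" "p (x + y) = p x + p y" "p (scale c x) = scale c (p x)" for c x y
      by (simp_all add: p_def add_divide_distrib scale_left_distrib sum.distrib scale_sum_right)
    then show "subspace {y. p y = y}" by (intro subspaceI) auto
    show "p y = y" if "y \<in> set bs" for y
    proof -
      from that obtain j where j: "j < length bs" "y = bs ! j" by (metis in_set_conv_nth)
      have "p y = (\<Sum>i<length bs. if i = j then bs ! i else 0)"
        unfolding p_def using j dual s by (intro sum.cong) auto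
      with j show ?thesis by simp
    qed
  qed
  show "regular_subspace \<phi> (span (set bs))"
    unfolding regular_subspace_def
  proof (intro conjI subspace_span equalityI subsetI)
    fix y assume y: "y \<in> span (set bs) \<inter> orth_complement \<phi> (span (set bs))"
    have "\<phi> y (bs ! \<sigma> i) = 0" if "i < length bs" for i
      using y \<sigma>(1)[OF that] by (auto simp: orth_complement_def span_base)
    then have "p y = 0" by (simp add: p_def)
    with p_id y show "y \<in> {0}" by simp
  qed (auto simp: orth_complement_def span_zero)
qed

lemma representation_scaled_basis_vector:
  assumes "distinct bs" "independent (set bs)" "i < length bs" "l < length bs"
  shows "representation (set bs) (scale c (bs ! l)) (bs ! i) = (if i = l then c else 0)"
  using assms
  by (simp add: representation_scale representation_basis span_base nth_eq_iff_index_eq)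

lemma delta_span_subset:
  assumes "\<And>j. j < length bs \<Longrightarrow> \<delta> (bs ! j) \<in> span (set bs)"
  shows "\<delta> ` span (set bs) \<subseteq> span (set bs)"
proof (rule image_subsetI)
  fix x assume "x \<in> span (set bs)"
  then show "\<delta> x \<in> span (set bs)"
  proof (rule span_induct)
    show "subspace {x. \<delta> x \<in> span (set bs)}"
      by (rule subspaceI) (auto intro: span_zero span_add span_scale)
    show "\<delta> x \<in> span (set bs)" if "x \<in> set bs" for x
      using assms that by (metis in_set_conv_nth)
  qed
qed

lemma dim_span_basis: "distinct bs \<Longrightarrow> independent (set bs) \<Longrightarrow> dim (span (set bs)) = length bs"
  by (metis dim_span_eq_card_independent distinct_card)

text \<open>The basis of an odd block, generated by one vector \<open>v\<close>: the powers \<open>\<delta>\<^sup>n\<^sup>-\<^sup>1 v, \<dots>, \<delta> v, v\<close> descend,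
  so that \<open>\<delta>\<close> acts on them by a Jordan block; then \<open>\<delta>\<^sup>n v\<close> and the higher powers follow with
  alternating signs, which cancel those coming from skewness, so that all nonzero Gram
  entries agree.\<close>

definition odd_chain :: "nat \<Rightarrow> 'b \<Rightarrow> 'b list" where
  "odd_chain n v = map (\<lambda>i. if i < n then (\<delta> ^^ (n - 1 - i)) v
     else scale ((- 1) ^ (i - n)) ((\<delta> ^^ i) v)) [0..<2 * n + 1]"

text \<open>The basis of an even block: the chain of \<open>v\<close> in descending order, then that of \<open>w\<close> in ascending
  order with alternating signs.\<close>

definition even_chain :: "nat \<Rightarrow> 'b \<Rightarrow> 'b \<Rightarrow> 'b list" where
  "even_chain m v w = map (\<lambda>i. if i < 2 * m then (\<delta> ^^ (2 * m - 1 - i)) v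
     else scale ((- 1) ^ (i - 2 * m)) ((\<delta> ^^ (i - 2 * m)) w)) [0..<4 * m]"

lemma odd_chain_length [simp]: "length (odd_chain n v) = 2 * n + 1"
  by (simp add: odd_chain_def)

lemma even_chain_length [simp]: "length (even_chain m v w) = 4 * m"
  by (simp add: even_chain_def)

lemma odd_chain_nth:
  assumes "i < 2 * n + 1"
  shows "odd_chain n v ! i = (if i < n then (\<delta> ^^ (n - 1 - i)) v
     else scale ((- 1) ^ (i - n)) ((\<delta> ^^ i) v))"
  using assms by (simp add: odd_chain_def del: upt_Suc)

lemma even_chain_nth:
  assumes "i < 4 * m"
  shows "even_chain m v w ! i = (if i < 2 * m then (\<delta> ^^ (2 * m - 1 - i)) v
     else scale ((- 1) ^ (i - 2 * m)) ((\<delta> ^^ (i - 2 * m)) w))"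
  using assms by (simp add: even_chain_def del: upt_Suc)

lemma odd_chain_delta:
  assumes "j < 2 * n + 1" and "(\<delta> ^^ (2 * n + 1)) v = 0"
  shows "\<delta> (odd_chain n v ! j) =
    (if j < n then odd_chain n v ! (if j = 0 then n else j - 1)
     else if j < 2 * n then scale (- 1) (odd_chain n v ! Suc j) else 0)"
proof -
  consider "j < n" "j = 0" | "j < n" "j \<noteq> 0" | "n \<le> j" "j < 2 * n" | "n \<le> j" "j = 2 * n"
    using assms(1) by linarith
  then show ?thesis
  proof cases
    case 1
    then have "\<delta> ((\<delta> ^^ (n - 1)) v) = (\<delta> ^^ n) v" by (cases n) auto
    with 1 show ?thesis by (simp add: odd_chain_nth)
  next
    case 2
    then have "n - 1 - (j - 1) = Suc (n - 1 - j)" "j - 1 < n" by simp_all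
    with 2 show ?thesis by (simp add: odd_chain_nth)
  next
    case 3
    then show ?thesis by (simp add: odd_chain_nth Suc_diff_le)
  next
    case 4
    then show ?thesis using assms by (simp add: odd_chain_nth)
  qed
qed

lemma even_chain_delta:
  assumes "j < 4 * m" and "(\<delta> ^^ (2 * m)) v = 0" and "(\<delta> ^^ (2 * m)) w = 0"
  shows "\<delta> (even_chain m v w ! j) =
    (if j < 2 * m then if j = 0 then 0 else even_chain m v w ! (j - 1)
     else if j < 4 * m - 1 then scale (- 1) (even_chain m v w ! Suc j) else 0)"
proof -
  consider "j = 0" | "j < 2 * m" "j \<noteq> 0" | "2 * m \<le> j" "j < 4 * m - 1" | "2 * m \<le> j" "j = 4 * m - 1"
    using assms(1) by linarith
  then show ?thesis
  proof cases
    case 1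
    have "\<delta> ((\<delta> ^^ (2 * m - 1)) v) = (\<delta> ^^ Suc (2 * m - 1)) v" by simp
    also have "Suc (2 * m - 1) = 2 * m" using assms(1) by simp
    finally show ?thesis using 1 assms by (simp add: even_chain_nth)
  next
    case 2
    then have "2 * m - 1 - (j - 1) = Suc (2 * m - 1 - j)" "j - 1 < 2 * m" by simp_all
    with 2 show ?thesis by (simp add: even_chain_nth)
  next
    case 3
    then show ?thesis by (simp add: even_chain_nth Suc_diff_le)
  next
    case 4
    then have "j - 2 * m = 2 * m - 1" using assms(1) by simp
    moreover have "\<delta> ((\<delta> ^^ (2 * m - 1)) w) = (\<delta> ^^ Suc (2 * m - 1)) w" by simp
    moreover have "Suc (2 * m - 1) = 2 * m" using assms(1) by simp
    ultimately show ?thesis using 4 assms by (simp add: even_chain_nth)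
  qed
qed

lemma odd_chain_gram:
  assumes top: "(\<delta> ^^ (2 * n + 1)) v = 0"
    and iso: "\<And>j. j < 2 * n \<Longrightarrow> \<phi> v ((\<delta> ^^ j) v) = 0"
    and \<mu>: "\<phi> v ((\<delta> ^^ (2 * n)) v) = \<mu>"
    and ij: "i < 2 * n + 1" "j < 2 * n + 1"
  shows "\<phi> (odd_chain n v ! i) (odd_chain n v ! j) =
    (if j = (if i < n then i + n + 1 else if i = n then n else i - n - 1)
     then (- 1) ^ n * \<mu> else 0)"
proof -
  have pair: "\<phi> v ((\<delta> ^^ l) v) = (if l = 2 * n then \<mu> else 0)" for l
    using iso[of l] \<mu> delta_pow_vanish[OF top, of l] by (cases l "2 * n" rule: linorder_cases) auto
  consider "i < n" "j < n" | "i < n" "n \<le> j" | "n \<le> i" "j < n" | "n \<le> i" "n \<le> j" by linarith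
  then show ?thesis
  proof cases
    case 1
    then show ?thesis using ij by (simp add: odd_chain_nth skew_pow pair)
  next
    case 2
    have entry: "\<phi> (odd_chain n v ! i) (odd_chain n v ! j) =
        ((- 1) ^ (j - n) * (- 1) ^ (n - 1 - i)) * (if (n - 1 - i) + j = 2 * n then \<mu> else 0)"
      using 2 ij by (simp add: odd_chain_nth skew_pow pair)
    have "(- 1 :: 'a) ^ (j - n) * (- 1) ^ (n - 1 - i) = (- 1) ^ n" if "j = i + n + 1"
    proof -
      have "(j - n) + (n - 1 - i) = n" using 2 that by linarith
      then show ?thesis by (metis power_add)
    qed
    moreover have "(n - 1 - i) + j = 2 * n \<longleftrightarrow> j = i + n + 1" using 2 by linarith
    ultimately show ?thesis using 2 entry by simp
  next
    case 3
    have entry: "\<phi> (odd_chain n v ! i) (odd_chain n v ! j) =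
        ((- 1) ^ (i - n) * (- 1) ^ i) * (if i + (n - 1 - j) = 2 * n then \<mu> else 0)"
      using 3 ij by (simp add: odd_chain_nth skew_pow pair)
    have "(- 1 :: 'a) ^ (i - n) * (- 1) ^ i = (- 1) ^ n"
      using 3 by (simp add: minus_one_power_iff)
    moreover have "i + (n - 1 - j) = 2 * n \<longleftrightarrow> i \<noteq> n \<and> j = i - n - 1"
      using 3 by linarith
    ultimately show ?thesis using 3 entry by simp
  next
    case 4
    have entry: "\<phi> (odd_chain n v ! i) (odd_chain n v ! j) =
        (- 1) ^ (j - n) * (- 1) ^ (i - n) * (- 1) ^ i * (if i + j = 2 * n then \<mu> else 0)"
      using 4 ij by (simp add: odd_chain_nth skew_pow pair)
    show ?thesis
    proof (cases "i = n")
      case True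
      then show ?thesis unfolding entry by (cases "j = n") simp_all
    next
      case False
      then have "i + j \<noteq> 2 * n" "\<not> i < n" "j \<noteq> i - n - 1" using 4 ij by linarith+
      with False show ?thesis unfolding entry by simp
    qed
  qed
qed

lemma even_chain_gram:
  assumes top: "(\<delta> ^^ (2 * m)) v = 0" "(\<delta> ^^ (2 * m)) w = 0"
    and iso: "\<And>j. \<phi> v ((\<delta> ^^ j) v) = 0" "\<And>j. \<phi> w ((\<delta> ^^ j) w) = 0"
    and cross: "\<And>j. j < 2 * m - 1 \<Longrightarrow> \<phi> v ((\<delta> ^^ j) w) = 0"
    and norm: "\<phi> v ((\<delta> ^^ (2 * m - 1)) w) = - 1"
    and ij: "i < 4 * m" "j < 4 * m"
  shows "\<phi> (even_chain m v w ! i) (even_chain m v w ! j) =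
    (if j = (if i < 2 * m then i + 2 * m else i - 2 * m) then 1 else 0)"
proof -
  have pair: "\<phi> v ((\<delta> ^^ l) w) = (if l = 2 * m - 1 then - 1 else 0)" for l
    using cross[of l] norm delta_pow_vanish[OF top(2), of l]
    by (cases l "2 * m - 1" rule: linorder_cases) auto
  have upper: "\<phi> (even_chain m v w ! i) (even_chain m v w ! j) = (if j = i + 2 * m then 1 else 0)"
    if "i < 2 * m" "2 * m \<le> j" "j < 4 * m" for i j
  proof -
    have "(- 1 :: 'a) ^ (2 * m - 1 - i) * (- 1) ^ (j - 2 * m) = - 1" if "j = i + 2 * m"
    proof -
      have "(2 * m - 1 - i) + (j - 2 * m) = 2 * m - 1" using \<open>i < 2 * m\<close> that by simp
      moreover have "odd (2 * m - 1)" using \<open>i < 2 * m\<close> by simp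
      ultimately show ?thesis by (metis power_add power_minus_odd power_one)
    qed
    moreover have "(2 * m - 1 - i) + (j - 2 * m) = 2 * m - 1 \<longleftrightarrow> j = i + 2 * m"
      using that by linarith
    ultimately show ?thesis using that by (auto simp: even_chain_nth skew_pow pair mult.commute)
  qed
  consider "i < 2 * m" "j < 2 * m" | "i < 2 * m" "2 * m \<le> j" | "2 * m \<le> i" "j < 2 * m"
    | "2 * m \<le> i" "2 * m \<le> j" by linarith
  then show ?thesis
  proof cases
    case 1
    then show ?thesis using ij by (simp add: even_chain_nth skew_pow iso)
  next
    case 2
    then show ?thesis using ij upper by simp
  next
    case 3
    then show ?thesis using ij upper[of j i] by (auto simp: phi_sym)
  next
    case 4
    then show ?thesis using ij by (simp add: even_chain_nth skew_pow iso)
  qed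
qed

text \<open>The parameter \<open>k\<close> is the nilpotency index, which bounds the size of the block.\<close>

definition standard_block :: "nat \<Rightarrow> 'b set \<Rightarrow> bool" where
  "standard_block k W \<longleftrightarrow>
    \<delta> ` W \<subseteq> W \<and> regular_subspace \<phi> W \<and>
    ((\<exists>n. dim W = 2 * n + 1 \<and> n \<le> (k - 1) div 2 \<and>
        (\<exists>\<mu> bs. \<mu> \<noteq> 0 \<and> ordered_basis bs W \<and>
          map_matrix \<delta> bs = odd_map_matrix n \<and> gram_matrix \<phi> bs = odd_form_matrix n \<mu>)) \<or>
     (\<exists>m\<ge>1. dim W = 4 * m \<and> m \<le> k div 2 \<and>
        (\<exists>bs. ordered_basis bs W \<and>
          map_matrix \<delta> bs = even_map_matrix m \<and> gram_matrix \<phi> bs = even_form_matrix m)))"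

lemma odd_chain_block:
  assumes top: "(\<delta> ^^ (2 * n + 1)) v = 0"
    and iso: "\<And>j. j < 2 * n \<Longrightarrow> \<phi> v ((\<delta> ^^ j) v) = 0"
    and nonzero: "\<phi> v ((\<delta> ^^ (2 * n)) v) \<noteq> 0"
    and k: "2 * n < k"
  shows "standard_block k (span (set (odd_chain n v)))"
    and "\<exists>b\<in>span (set (odd_chain n v)). x - b \<in> orth_complement \<phi> (span (set (odd_chain n v)))"
proof -
  define \<mu> where "\<mu> = \<phi> v ((\<delta> ^^ (2 * n)) v)"
  define bs where "bs = odd_chain n v"
  define \<sigma> where "\<sigma> i = (if i < n then i + n + 1 else if i = n then n else i - n - 1)" for i
  have len: "length bs = 2 * n + 1" by (simp add: bs_def)
  have gram: "\<phi> (bs ! i) (bs ! j) = (if j = \<sigma> i then (- 1) ^ n * \<mu> else 0)"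
    if "i < length bs" "j < length bs" for i j
    using odd_chain_gram[OF top iso \<mu>_def[symmetric], of i j] that unfolding bs_def \<sigma>_def by simp
  have \<sigma>: "\<sigma> i < length bs" "\<sigma> (\<sigma> i) = i" if "i < length bs" for i
    using that by (auto simp: \<sigma>_def len)
  have s: "(- 1) ^ n * \<mu> \<noteq> 0" using nonzero by (simp add: \<mu>_def)
  have basis: "distinct bs" "independent (set bs)" "regular_subspace \<phi> (span (set bs))"
    "\<exists>b\<in>span (set bs). x - b \<in> orth_complement \<phi> (span (set bs))" for x
    by (rule involutive_gram_basis[of bs \<sigma> "(- 1) ^ n * \<mu>"], erule (1) gram, erule \<sigma>(1),
        erule \<sigma>(2), rule s)+
  show "\<exists>b\<in>span (set (odd_chain n v)). x - b \<in> orth_complement \<phi> (span (set (odd_chain n v)))"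
    using basis(4) unfolding bs_def .
  have delta: "\<delta> (bs ! j) = (if j < n then bs ! (if j = 0 then n else j - 1)
     else if j < 2 * n then scale (- 1) (bs ! Suc j) else 0)" if "j < 2 * n + 1" for j
    using odd_chain_delta[OF that top] unfolding bs_def .
  have invariant: "\<delta> ` span (set bs) \<subseteq> span (set bs)"
    by (rule delta_span_subset) (use len delta in \<open>auto intro!: span_base span_neg span_zero nth_mem\<close>)
  have rep: "representation (set bs) (\<delta> (bs ! j)) (bs ! i) = odd_map_matrix n $$ (i, j)"
    if ij: "i < 2 * n + 1" "j < 2 * n + 1" for i j
  proof -
    note repr = representation_scaled_basis_vector[OF basis(1,2), unfolded len]
    consider "j < n" | "n \<le> j" "j < 2 * n" | "j = 2 * n" using ij by linarith
    then show ?thesis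
    proof cases
      case 1
      then have "(if j = 0 then n else j - 1) < 2 * n + 1" by auto
      from repr[OF ij(1) this, of 1] show ?thesis
        unfolding delta[OF ij(2)] odd_map_matrix_index[OF ij] using 1 by simp
    next
      case 2
      then have "Suc j < 2 * n + 1" by simp
      from repr[OF ij(1) this, of "- 1"] show ?thesis
        unfolding delta[OF ij(2)] odd_map_matrix_index[OF ij] using 2 by simp
    next
      case 3
      with ij show ?thesis
        unfolding delta[OF ij(2)] odd_map_matrix_index[OF ij] by (simp add: representation_zero)
    qed
  qed
  have "map_matrix \<delta> bs = odd_map_matrix n"
    by (rule eq_matI) (use len rep in \<open>auto simp: map_matrix_def\<close>)
  moreover have "gram_matrix \<phi> bs = odd_form_matrix n \<mu>"
    by (rule eq_matI) (use len gram in \<open>auto simp: gram_matrix_def odd_form_matrix_index \<sigma>_def\<close>)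
  moreover have "ordered_basis bs (span (set bs))" using basis(1,2) by (simp add: ordered_basis_def)
  moreover have "dim (span (set bs)) = 2 * n + 1" using dim_span_basis[OF basis(1,2)] len by simp
  moreover have "n \<le> (k - 1) div 2" using k by linarith
  moreover have "\<mu> \<noteq> 0" using nonzero by (simp add: \<mu>_def)
  ultimately show "standard_block k (span (set (odd_chain n v)))"
    using invariant basis(3) unfolding standard_block_def bs_def[symmetric] by blast
qed

text \<open>The value \<open>- 1\<close> in the assumption compensates the sign that arises when the odd power
  \<open>\<delta>\<^sup>2\<^sup>m\<^sup>-\<^sup>1\<close> is distributed over both arguments of \<open>\<phi>\<close>, so that the Gram entries become \<open>1\<close>.\<close>

lemma even_chain_block:
  assumes top: "(\<delta> ^^ (2 * m)) v = 0" "(\<delta> ^^ (2 * m)) w = 0"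
    and iso: "\<And>j. \<phi> v ((\<delta> ^^ j) v) = 0" "\<And>j. \<phi> w ((\<delta> ^^ j) w) = 0"
    and cross: "\<And>j. j < 2 * m - 1 \<Longrightarrow> \<phi> v ((\<delta> ^^ j) w) = 0"
    and norm: "\<phi> v ((\<delta> ^^ (2 * m - 1)) w) = - 1"
    and m: "1 \<le> m" "2 * m \<le> k"
  shows "standard_block k (span (set (even_chain m v w)))"
    and "\<exists>b\<in>span (set (even_chain m v w)). x - b \<in> orth_complement \<phi> (span (set (even_chain m v w)))"
proof -
  define bs where "bs = even_chain m v w"
  define \<sigma> where "\<sigma> i = (if i < 2 * m then i + 2 * m else i - 2 * m)" for i
  have len: "length bs = 4 * m" by (simp add: bs_def)
  have gram: "\<phi> (bs ! i) (bs ! j) = (if j = \<sigma> i then 1 else 0)"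
    if "i < length bs" "j < length bs" for i j
    using even_chain_gram[OF top iso cross norm, of i j] that unfolding bs_def \<sigma>_def by simp
  have \<sigma>: "\<sigma> i < length bs" "\<sigma> (\<sigma> i) = i" if "i < length bs" for i
    using that by (auto simp: \<sigma>_def len)
  have basis: "distinct bs" "independent (set bs)" "regular_subspace \<phi> (span (set bs))"
    "\<exists>b\<in>span (set bs). x - b \<in> orth_complement \<phi> (span (set bs))" for x
    by (rule involutive_gram_basis[of bs \<sigma> 1], erule (1) gram, erule \<sigma>(1),
        erule \<sigma>(2), rule one_neq_zero)+
  show "\<exists>b\<in>span (set (even_chain m v w)). x - b \<in> orth_complement \<phi> (span (set (even_chain m v w)))"
    using basis(4) unfolding bs_def .
  have delta: "\<delta> (bs ! j) = (if j < 2 * m then if j = 0 then 0 else bs ! (j - 1)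
     else if j < 4 * m - 1 then scale (- 1) (bs ! Suc j) else 0)" if "j < 4 * m" for j
    using even_chain_delta[OF that top] unfolding bs_def .
  have invariant: "\<delta> ` span (set bs) \<subseteq> span (set bs)"
    by (rule delta_span_subset) (use len delta in \<open>auto intro!: span_base span_neg span_zero nth_mem\<close>)
  have rep: "representation (set bs) (\<delta> (bs ! j)) (bs ! i) = even_map_matrix m $$ (i, j)"
    if ij: "i < 4 * m" "j < 4 * m" for i j
  proof -
    note repr = representation_scaled_basis_vector[OF basis(1,2), unfolded len]
    consider "j = 0" | "0 < j" "j < 2 * m" | "2 * m \<le> j" "j < 4 * m - 1" | "j = 4 * m - 1"
      using ij by linarith
    then show ?thesis
    proof cases
      case 1
      with ij show ?thesis
        unfolding delta[OF ij(2)] even_map_matrix_index[OF ij] by (simp add: representation_zero)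
    next
      case 2
      then have "j - 1 < 4 * m" "i = j - 1 \<longleftrightarrow> j = Suc i" by auto
      with repr[OF ij(1) this(1), of 1] show ?thesis
        unfolding delta[OF ij(2)] even_map_matrix_index[OF ij] using 2 by simp
    next
      case 3
      then have "Suc j < 4 * m" by simp
      from repr[OF ij(1) this, of "- 1"] show ?thesis
        unfolding delta[OF ij(2)] even_map_matrix_index[OF ij] using 3 by simp
    next
      case 4
      with ij have "\<not> j < 2 * m" "i \<noteq> Suc j" "\<not> j < 4 * m - 1" by linarith+
      then show ?thesis
        unfolding delta[OF ij(2)] even_map_matrix_index[OF ij] by (simp add: representation_zero)
    qed
  qed
  have "map_matrix \<delta> bs = even_map_matrix m"
    by (rule eq_matI) (use len rep in \<open>auto simp: map_matrix_def\<close>)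
  moreover have "gram_matrix \<phi> bs = even_form_matrix m"
    by (rule eq_matI) (use len gram in \<open>auto simp: gram_matrix_def even_form_matrix_index \<sigma>_def\<close>)
  moreover have "ordered_basis bs (span (set bs))" using basis(1,2) by (simp add: ordered_basis_def)
  moreover have "dim (span (set bs)) = 4 * m" using dim_span_basis[OF basis(1,2)] len by simp
  moreover have "m \<le> k div 2" using m(2) by linarith
  ultimately show "standard_block k (span (set (even_chain m v w)))"
    using invariant basis(3) m(1) unfolding standard_block_def bs_def[symmetric] by blast
qed

lemma odd_chain_subset:
  assumes "\<delta> ` U \<subseteq> U" "subspace U" "v \<in> U"
  shows "span (set (odd_chain n v)) \<subseteq> U"
  using assms delta_pow_in
  by (intro span_minimal) (auto simp: odd_chain_def simp del: upt_Suc intro!: subspace_scale)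

lemma even_chain_subset:
  assumes "\<delta> ` U \<subseteq> U" "subspace U" "v \<in> U" "w \<in> U"
  shows "span (set (even_chain m v w)) \<subseteq> U"
  using assms delta_pow_in
  by (intro span_minimal) (auto simp: even_chain_def simp del: upt_Suc intro!: subspace_scale)

section \<open>Orthogonalising the generators of a chain\<close>

text \<open>For odd \<open>j\<close> the value \<open>\<phi> a (\<delta>\<^sup>j a)\<close> vanishes anyway. For even \<open>j\<close>, adding a multiple of
  \<open>\<delta>\<^sup>N\<^sup>-\<^sup>j b\<close> to \<open>a\<close> changes \<open>\<phi> a (\<delta>\<^sup>j a)\<close> by a multiple of \<open>2 \<phi> a (\<delta>\<^sup>N b)\<close> and
  leaves \<open>\<phi> a (\<delta>\<^sup>l a)\<close> for \<open>l > j\<close> alone, because there only powers beyond \<open>\<delta>\<^sup>N\<close> enter. So the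
  unwanted values can be removed one at a time, for descending \<open>j\<close>. All corrections lie in \<open>\<delta> U\<close>,
  which is why the pairing with \<open>\<delta>\<^sup>N U\<close> is kept. The vector \<open>b\<close> may be \<open>a\<close> itself, which is the
  case needed for a block with one chain.\<close>

lemma isotropic_correction:
  assumes two: "(2::'a) \<noteq> 0"
    and U: "subspace U" "\<delta> ` U \<subseteq> U"
    and top: "\<And>x. x \<in> U \<Longrightarrow> (\<delta> ^^ Suc N) x = 0"
    and ab: "a \<in> U" "b \<in> U" "\<phi> a ((\<delta> ^^ N) b) \<noteq> 0"
  obtains a' where "a' \<in> U"
    and "\<And>x. x \<in> U \<Longrightarrow> \<phi> a' ((\<delta> ^^ N) x) = \<phi> a ((\<delta> ^^ N) x)"
    and "\<And>j. j < N \<Longrightarrow> \<phi> a' ((\<delta> ^^ j) a') = 0"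
proof -
  have vanish: "(\<delta> ^^ i) x = 0" if "x \<in> U" "N < i" for x i
    using delta_pow_vanish[OF top[OF that(1)]] that(2) by simp
  have "\<exists>a'\<in>U. (\<forall>x\<in>U. \<phi> a' ((\<delta> ^^ N) x) = \<phi> a ((\<delta> ^^ N) x)) \<and>
      (\<forall>j. N - i \<le> j \<and> j < N \<longrightarrow> \<phi> a' ((\<delta> ^^ j) a') = 0)" if "i \<le> N" for i
    using that
  proof (induction i)
    case 0
    then show ?case using ab by (intro bexI[of _ a]) auto
  next
    case (Suc i)
    define j where "j = N - Suc i"
    have j: "j + Suc i = N" "N - i = Suc j" using Suc.prems by (auto simp: j_def)
    obtain c where c: "c \<in> U" "\<forall>x\<in>U. \<phi> c ((\<delta> ^^ N) x) = \<phi> a ((\<delta> ^^ N) x)"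
      "\<And>l. Suc j \<le> l \<Longrightarrow> l < N \<Longrightarrow> \<phi> c ((\<delta> ^^ l) c) = 0"
      using Suc j by auto
    show ?case
    proof (cases "odd j")
      case True
      have "\<phi> c ((\<delta> ^^ l) c) = 0" if "j \<le> l" "l < N" for l
        using c(3)[of l] that odd_pow_isotropic[OF two True, of c] by (cases "l = j") auto
      then show ?thesis using c j_def by (intro bexI[of _ c]) auto
    next
      case False
      \<comment> \<open>Both mixed terms at exponent \<open>j\<close> equal \<open>r * \<phi> a ((\<delta> ^^ N) b)\<close>, since \<open>j\<close> is even; hence the \<open>2\<close>.\<close>
      define r where "r = - \<phi> c ((\<delta> ^^ j) c) / (2 * \<phi> a ((\<delta> ^^ N) b))"
      define e where "e = c + scale r ((\<delta> ^^ Suc i) b)"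
      have bU: "(\<delta> ^^ Suc i) b \<in> U" using delta_pow_in[OF U(2) ab(2)] .
      have eU: "e \<in> U" unfolding e_def using U(1) c(1) bU by (blast intro: subspace_add subspace_scale)
      have keep: "\<phi> e ((\<delta> ^^ N) x) = \<phi> a ((\<delta> ^^ N) x)" if "x \<in> U" for x
        using c(2) that vanish[OF that, of "Suc i + N"]
        by (simp add: e_def skew_pow del: funpow.simps)
      have expand: "\<phi> e ((\<delta> ^^ l) e) = \<phi> c ((\<delta> ^^ l) c) +
          r * \<phi> c ((\<delta> ^^ (l + Suc i)) b) + r * \<phi> ((\<delta> ^^ Suc i) b) ((\<delta> ^^ l) c)"
        if "j \<le> l" for l
      proof -
        have "\<phi> ((\<delta> ^^ Suc i) b) ((\<delta> ^^ (l + Suc i)) b) = 0"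
          using vanish[OF ab(2), of "Suc i + (l + Suc i)"] that j
          by (simp add: skew_pow del: funpow.simps)
        then show ?thesis by (simp add: e_def algebra_simps del: funpow.simps)
      qed
      have "\<phi> e ((\<delta> ^^ l) e) = 0" if "j \<le> l" "l < N" for l
      proof (cases "l = j")
        case True
        have "\<phi> ((\<delta> ^^ Suc i) b) ((\<delta> ^^ j) c) = (- 1) ^ Suc i * \<phi> b ((\<delta> ^^ N) c)"
          using j by (simp add: skew_pow add.commute del: funpow.simps)
        also have "\<dots> = (- 1) ^ Suc i * (- 1) ^ N * \<phi> c ((\<delta> ^^ N) b)"
          using skew_pow_flip[of b N c] by simp
        also have "(- 1 :: 'a) ^ Suc i * (- 1) ^ N = 1"
          using j(1)[symmetric] False by (simp add: power_add)
        finally show ?thesis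
          using expand[of j] c(2) ab two True j(1)
          by (simp add: r_def field_simps del: funpow.simps)
      next
        case False
        then have "(\<delta> ^^ (l + Suc i)) b = 0" "(\<delta> ^^ (Suc i + l)) c = 0"
          using that j vanish[OF ab(2), of "l + Suc i"] vanish[OF c(1), of "Suc i + l"] by auto
        then show ?thesis using expand[OF that(1)] c(3)[of l] that False
          by (simp add: skew_pow del: funpow.simps)
      qed
      then show ?thesis using eU keep j_def by (intro bexI[of _ e]) auto
    qed
  qed
  from this[of N] show ?thesis using that by auto
qed

text \<open>The same descent for a pair: replacing \<open>w\<close> by a combination of \<open>w, \<delta> w, \<delta>\<^sup>2 w, \<dots>\<close> removes the
  values \<open>\<phi> v (\<delta>\<^sup>j w)\<close> below the top one. Since the whole chain of \<open>w\<close> is totally isotropic, it stays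
  so.\<close>

lemma pairing_correction:
  assumes U: "subspace U" "\<delta> ` U \<subseteq> U"
    and top: "\<And>x. x \<in> U \<Longrightarrow> (\<delta> ^^ Suc N) x = 0"
    and vw: "w \<in> U" "\<phi> v ((\<delta> ^^ N) w) \<noteq> 0"
    and iso: "\<And>j. \<phi> w ((\<delta> ^^ j) w) = 0"
  obtains w' where "w' \<in> U" and "\<And>j. \<phi> w' ((\<delta> ^^ j) w') = 0"
    and "\<phi> v ((\<delta> ^^ N) w') = \<phi> v ((\<delta> ^^ N) w)"
    and "\<And>j. j < N \<Longrightarrow> \<phi> v ((\<delta> ^^ j) w') = 0"
proof -
  have vanish: "(\<delta> ^^ i) x = 0" if "x \<in> U" "N < i" for x i
    using delta_pow_vanish[OF top[OF that(1)]] that(2) by simp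
  have "\<exists>w'\<in>U. (\<forall>j. \<phi> w' ((\<delta> ^^ j) w') = 0) \<and> \<phi> v ((\<delta> ^^ N) w') = \<phi> v ((\<delta> ^^ N) w) \<and>
      (\<forall>j. N - i \<le> j \<and> j < N \<longrightarrow> \<phi> v ((\<delta> ^^ j) w') = 0)" if "i \<le> N" for i
    using that
  proof (induction i)
    case 0
    then show ?case using vw iso by (intro bexI[of _ w]) auto
  next
    case (Suc i)
    define j where "j = N - Suc i"
    have j: "j + Suc i = N" "N - i = Suc j" using Suc.prems by (auto simp: j_def)
    obtain c where c: "c \<in> U" "\<And>l. \<phi> c ((\<delta> ^^ l) c) = 0"
      "\<phi> v ((\<delta> ^^ N) c) = \<phi> v ((\<delta> ^^ N) w)"
      "\<And>l. Suc j \<le> l \<Longrightarrow> l < N \<Longrightarrow> \<phi> v ((\<delta> ^^ l) c) = 0"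
      using Suc j by auto
    define r where "r = - \<phi> v ((\<delta> ^^ j) c) / \<phi> v ((\<delta> ^^ N) w)"
    define e where "e = c + scale r ((\<delta> ^^ Suc i) c)"
    have "(\<delta> ^^ Suc i) c \<in> U" using delta_pow_in[OF U(2) c(1)] .
    then have eU: "e \<in> U"
      unfolding e_def using U(1) c(1) by (blast intro: subspace_add subspace_scale)
    have iso_e: "\<phi> e ((\<delta> ^^ l) e) = 0" for l
      by (simp add: e_def c(2) skew_pow del: funpow.simps)
    have keep: "\<phi> v ((\<delta> ^^ N) e) = \<phi> v ((\<delta> ^^ N) w)"
      using c(3) vanish[OF c(1), of "N + Suc i"] by (simp add: e_def del: funpow.simps)
    have "\<phi> v ((\<delta> ^^ l) e) = 0" if "j \<le> l" "l < N" for l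
    proof (cases "l = j")
      case True
      have "\<phi> v ((\<delta> ^^ j) e) = \<phi> v ((\<delta> ^^ j) c) + r * \<phi> v ((\<delta> ^^ N) c)"
        using j(1) by (simp add: e_def del: funpow.simps)
      then show ?thesis using vw c(3) True by (simp add: r_def)
    next
      case False
      then show ?thesis using that c(4)[of l] vanish[OF c(1), of "l + Suc i"] j
        by (simp add: e_def del: funpow.simps)
    qed
    then show ?case using eU iso_e keep j_def by (intro bexI[of _ e]) auto
  qed
  from this[of N] show ?thesis using that by auto
qed

section \<open>Splitting off blocks\<close>

text \<open>Let \<open>\<delta>\<^sup>N\<close> be the last power that does not vanish on \<open>U\<close>; by regularity \<open>\<phi> x (\<delta>\<^sup>N y)\<close> is a nonzero
  form on \<open>U\<close>. For even \<open>N\<close> it is symmetric, so by polarisation some \<open>a\<close> has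
  \<open>\<phi> a (\<delta>\<^sup>N a) \<noteq> 0\<close>, and after correction the chain of one vector spans a block of dimension \<open>N + 1\<close>.
  For odd \<open>N\<close> it is alternating, so two chains of length \<open>N + 1\<close> are needed; both are made isotropic
  and then dual to each other.\<close>

lemma ex_standard_block:
  assumes two: "(2::'a) \<noteq> 0"
    and nil: "\<delta> ^^ k = (\<lambda>_. 0)"
    and U: "\<delta> ` U \<subseteq> U" "regular_subspace \<phi> U" "U \<noteq> {0}"
  obtains B where "B \<subseteq> U" "standard_block k B"
    and "\<And>x. \<exists>b\<in>B. x - b \<in> orth_complement \<phi> B"
proof -
  have sub: "subspace U" and reg: "U \<inter> orth_complement \<phi> U = {0}"
    using U(2) by (auto simp: regular_subspace_def)
  define d where "d = (LEAST d. \<forall>x\<in>U. (\<delta> ^^ d) x = 0)"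
  have k0: "\<forall>x\<in>U. (\<delta> ^^ k) x = 0" using nil by simp
  have d: "\<forall>x\<in>U. (\<delta> ^^ d) x = 0" unfolding d_def by (rule LeastI, rule k0)
  have "d \<le> k" unfolding d_def by (rule Least_le, rule k0)
  have "d \<noteq> 0"
  proof
    assume "d = 0"
    with d have "U \<subseteq> {0}" by auto
    with U(3) sub subspace_0 show False by blast
  qed
  then obtain N where N: "d = Suc N" by (cases d) auto
  have top: "(\<delta> ^^ Suc N) x = 0" if "x \<in> U" for x using d that N by simp
  have vanish: "(\<delta> ^^ i) x = 0" if "x \<in> U" "N < i" for x i
    using delta_pow_vanish[OF top[OF that(1)]] that(2) by simp
  obtain y where y: "y \<in> U" "(\<delta> ^^ N) y \<noteq> 0"
    using not_less_Least[of N "\<lambda>d. \<forall>x\<in>U. (\<delta> ^^ d) x = 0"] N unfolding d_def by auto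
  have "(\<delta> ^^ N) y \<in> U" using delta_pow_in[OF U(1) y(1)] .
  with y(2) reg have "(\<delta> ^^ N) y \<notin> orth_complement \<phi> U" by blast
  then obtain x where x: "x \<in> U" "\<phi> x ((\<delta> ^^ N) y) \<noteq> 0"
    by (auto simp: orth_complement_def phi_sym)
  show ?thesis
  proof (cases "even N")
    case True
    obtain a where a: "a \<in> U" "\<phi> a ((\<delta> ^^ N) a) \<noteq> 0"
    proof (cases "\<phi> x ((\<delta> ^^ N) x) = 0 \<and> \<phi> y ((\<delta> ^^ N) y) = 0")
      case zero: True
      have "\<phi> (x + y) ((\<delta> ^^ N) (x + y)) = 2 * \<phi> x ((\<delta> ^^ N) y)"
        using zero skew_pow_flip[of y N x] True by simp
      with two x(2) have "\<phi> (x + y) ((\<delta> ^^ N) (x + y)) \<noteq> 0" by (metis mult_eq_0_iff)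
      with subspace_add[OF sub x(1) y(1)] show ?thesis by (rule that)
    next
      case False
      then show ?thesis using that x y by blast
    qed
    obtain v where v: "v \<in> U" "\<And>z. z \<in> U \<Longrightarrow> \<phi> v ((\<delta> ^^ N) z) = \<phi> a ((\<delta> ^^ N) z)"
      "\<And>j. j < N \<Longrightarrow> \<phi> v ((\<delta> ^^ j) v) = 0"
      using isotropic_correction[OF two sub U(1) top a(1) a(1) a(2)] by metis
    have "\<phi> v ((\<delta> ^^ N) v) = \<phi> a ((\<delta> ^^ N) a)"
      using v(2)[OF v(1)] v(2)[OF a(1)] skew_pow_flip[of a N v] True by simp
    with a have nz: "\<phi> v ((\<delta> ^^ N) v) \<noteq> 0" by simp
    from True obtain n where n: "N = 2 * n" by (elim evenE)
    have hyps: "(\<delta> ^^ (2 * n + 1)) v = 0" "\<phi> v ((\<delta> ^^ (2 * n)) v) \<noteq> 0" "2 * n < k"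
      "\<And>j. j < 2 * n \<Longrightarrow> \<phi> v ((\<delta> ^^ j) v) = 0"
      using top[OF v(1)] nz v(3) n N \<open>d \<le> k\<close> by auto
    show ?thesis
      by (rule that[OF odd_chain_subset[OF U(1) sub v(1)]])
        (use odd_chain_block[OF hyps(1,4,2,3)] in blast)+
  next
    case False
    have flip: "\<phi> p ((\<delta> ^^ N) q) = - \<phi> q ((\<delta> ^^ N) p)" for p q
      using skew_pow_flip[of p N q] False by simp
    have all: "\<phi> v ((\<delta> ^^ j) v) = 0" if "v \<in> U" "\<And>j. j < N \<Longrightarrow> \<phi> v ((\<delta> ^^ j) v) = 0" for v j
      using that(2)[of j] vanish[OF that(1), of j] odd_pow_isotropic[OF two False, of v]
      by (cases j N rule: linorder_cases) auto
    \<comment> \<open>The correction of the second vector uses the already corrected first one, and only then are the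
      two paired: in this order each step preserves what the previous ones achieved.\<close>
    obtain v where v: "v \<in> U" "\<And>z. z \<in> U \<Longrightarrow> \<phi> v ((\<delta> ^^ N) z) = \<phi> x ((\<delta> ^^ N) z)"
      "\<And>j. j < N \<Longrightarrow> \<phi> v ((\<delta> ^^ j) v) = 0"
      using isotropic_correction[OF two sub U(1) top x(1) y(1) x(2)] by metis
    have "\<phi> y ((\<delta> ^^ N) v) \<noteq> 0" using flip[of y v] v(2)[OF y(1)] x(2) by simp
    then obtain w1 where w1: "w1 \<in> U"
      "\<And>z. z \<in> U \<Longrightarrow> \<phi> w1 ((\<delta> ^^ N) z) = \<phi> y ((\<delta> ^^ N) z)"
      "\<And>j. j < N \<Longrightarrow> \<phi> w1 ((\<delta> ^^ j) w1) = 0"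
      using isotropic_correction[OF two sub U(1) top y(1) v(1)] by metis
    have "\<phi> v ((\<delta> ^^ N) w1) \<noteq> 0"
      using flip[of v w1] w1(2)[OF v(1)] \<open>\<phi> y ((\<delta> ^^ N) v) \<noteq> 0\<close> by simp
    then obtain w2 where w2: "w2 \<in> U" "\<And>j. \<phi> w2 ((\<delta> ^^ j) w2) = 0"
      "\<phi> v ((\<delta> ^^ N) w2) \<noteq> 0" "\<And>j. j < N \<Longrightarrow> \<phi> v ((\<delta> ^^ j) w2) = 0"
      using pairing_correction[OF sub U(1) top w1(1) _ all[OF w1(1,3)]] by metis
    define w where "w = scale (- 1 / \<phi> v ((\<delta> ^^ N) w2)) w2"
    have "w \<in> U" unfolding w_def by (rule subspace_scale[OF sub w2(1)])
    then have w: "w \<in> U" "\<And>j. \<phi> w ((\<delta> ^^ j) w) = 0" "\<phi> v ((\<delta> ^^ N) w) = - 1"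
      "\<And>j. j < N \<Longrightarrow> \<phi> v ((\<delta> ^^ j) w) = 0"
      using w2 by (simp_all add: w_def)
    from False obtain n where n: "N = 2 * n + 1" by (elim oddE)
    define m where "m = Suc n"
    have m: "N = 2 * m - 1" "Suc N = 2 * m" "1 \<le> m" using n by (simp_all add: m_def)
    have hyps: "(\<delta> ^^ (2 * m)) v = 0" "(\<delta> ^^ (2 * m)) w = 0" "2 * m \<le> k"
      "\<phi> v ((\<delta> ^^ (2 * m - 1)) w) = - 1" "\<And>j. j < 2 * m - 1 \<Longrightarrow> \<phi> v ((\<delta> ^^ j) w) = 0"
      using top[OF v(1)] top[OF w(1)] w m N \<open>d \<le> k\<close> by auto
    show ?thesis
      by (rule that[OF even_chain_subset[OF U(1) sub v(1) w(1)]])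
        (use even_chain_block[OF hyps(1,2) all[OF v(1,3)] w(2) hyps(5,4) m(3) hyps(3)] in blast)+
  qed
qed

lemma standard_block_nonzero:
  assumes "standard_block k B" shows "B \<noteq> {0}"
proof
  assume "B = {0}"
  then have "dim B = 0" by simp
  with assms show False by (auto simp: standard_block_def)
qed

text \<open>Split off one block \<open>B\<close> and continue with \<open>U \<inter> B\<^sup>\<bottom>\<close>, which is again regular, and invariant
  because \<open>\<delta>\<close> is skew.\<close>

lemma orthogonal_block_decomposition:
  assumes two: "(2::'a) \<noteq> 0" and nil: "\<delta> ^^ k = (\<lambda>_. 0)"
    and U: "\<delta> ` U \<subseteq> U" "regular_subspace \<phi> U"
  shows "\<exists>(r::nat) W. (\<forall>i<r. standard_block k (W i) \<and> W i \<subseteq> U) \<and>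
    (\<forall>i<r. \<forall>j<r. i \<noteq> j \<longrightarrow> (\<forall>x\<in>W i. \<forall>y\<in>W j. \<phi> x y = 0)) \<and>
    (\<forall>u\<in>U. \<exists>w. (\<forall>i<r. w i \<in> W i) \<and> u = (\<Sum>i<r. w i))"
  using U
proof (induction "dim U" arbitrary: U rule: less_induct)
  case less
  show ?case
  proof (cases "U = {0}")
    case True
    then show ?thesis by (intro exI[of _ "0::nat"]) simp
  next
    case False
    have sub: "subspace U" and reg: "U \<inter> orth_complement \<phi> U = {0}"
      using less.prems by (auto simp: regular_subspace_def)
    obtain B where B: "B \<subseteq> U" "standard_block k B"
      "\<And>x. \<exists>b\<in>B. x - b \<in> orth_complement \<phi> B"
      using ex_standard_block[OF two nil less.prems False] by metis
    have subB: "subspace B" and regB: "B \<inter> orth_complement \<phi> B = {0}" and invB: "\<delta> ` B \<subseteq> B"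
      using B(2) by (auto simp: standard_block_def regular_subspace_def)
    define U' where "U' = U \<inter> orth_complement \<phi> B"
    have split: "\<exists>b\<in>B. \<exists>u'\<in>U'. u = b + u'" if u: "u \<in> U" for u
    proof -
      obtain b where b: "b \<in> B" "u - b \<in> orth_complement \<phi> B" using B(3) by blast
      moreover have "u - b \<in> U" using b(1) B(1) u sub by (auto intro: subspace_diff)
      ultimately show ?thesis by (intro bexI[of _ b] bexI[of _ "u - b"]) (auto simp: U'_def)
    qed
    have perp: "\<phi> x b = 0" "\<phi> b x = 0" if "x \<in> U'" "b \<in> B" for x b
      using that by (auto simp: U'_def orth_complement_def phi_sym)
    have sub': "subspace U'"
      using sub by (auto simp: U'_def orth_complement_def subspace_def)
    have inv': "\<delta> ` U' \<subseteq> U'"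
      using less.prems(1) invB by (auto simp: U'_def orth_complement_def skew)
    have "x = 0" if x: "x \<in> U'" "x \<in> orth_complement \<phi> U'" for x
    proof -
      have "\<phi> x u = 0" if "u \<in> U" for u
        using split[OF that] x perp by (auto simp: orth_complement_def)
      with x reg show ?thesis by (auto simp: orth_complement_def U'_def)
    qed
    then have reg': "regular_subspace \<phi> U'"
      using sub' subspace_0[OF sub'] by (auto simp: regular_subspace_def orth_complement_def)
    have "dim U' < dim U"
    proof -
      obtain b where "b \<in> B" "b \<noteq> 0"
        using standard_block_nonzero[OF B(2)] subspace_0[OF subB] by blast
      then have "b \<in> U - U'" using B(1) regB by (auto simp: U'_def)
      then have "U' \<subset> U" by (auto simp: U'_def)
      then show ?thesis using sub sub' by (intro dim_psubset) (simp add: span_eq_iff[THEN iffD2])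
    qed
    from less.hyps[OF this inv' reg'] obtain r :: nat and W where
      W: "\<forall>i<r. standard_block k (W i) \<and> W i \<subseteq> U'"
      "\<forall>i<r. \<forall>j<r. i \<noteq> j \<longrightarrow> (\<forall>x\<in>W i. \<forall>y\<in>W j. \<phi> x y = 0)"
      "\<forall>u\<in>U'. \<exists>w. (\<forall>i<r. w i \<in> W i) \<and> u = (\<Sum>i<r. w i)"
      by blast
    define W' where "W' = W(r := B)"
    have "\<forall>i<Suc r. standard_block k (W' i) \<and> W' i \<subseteq> U"
      using W(1) B by (auto simp: W'_def U'_def less_Suc_eq)
    moreover have "\<forall>i<Suc r. \<forall>j<Suc r. i \<noteq> j \<longrightarrow> (\<forall>x\<in>W' i. \<forall>y\<in>W' j. \<phi> x y = 0)"
      using W(1,2) perp unfolding W'_def less_Suc_eq by (simp add: subset_iff)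
    moreover have "\<exists>w. (\<forall>i<Suc r. w i \<in> W' i) \<and> u = (\<Sum>i<Suc r. w i)" if "u \<in> U" for u
    proof -
      from split[OF that] obtain b u' where b: "b \<in> B" "u' \<in> U'" "u = b + u'" by blast
      with W(3) obtain w where w: "\<forall>i<r. w i \<in> W i" "u' = (\<Sum>i<r. w i)" by blast
      have "(\<Sum>i<Suc r. (w(r := b)) i) = u" using b w by (simp add: add.commute)
      with w(1) b(1) show ?thesis
        by (intro exI[of _ "w(r := b)"]) (auto simp: W'_def less_Suc_eq)
    qed
    ultimately show ?thesis by (intro exI[of _ "Suc r"] exI[of _ W'] conjI ballI)
  qed
qed

text \<open>Regularity makes components unique: in a sum, pairing with \<open>W i\<close> sees only the \<open>i\<close>-th
  component, and this pairing is nondegenerate on \<open>W i\<close>.\<close>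

lemma orthogonal_regular_sum_direct:
  assumes "finite I" and W: "\<And>i. i \<in> I \<Longrightarrow> regular_subspace \<phi> (W i)"
    and orth: "\<And>i j x y. i \<in> I \<Longrightarrow> j \<in> I \<Longrightarrow> i \<noteq> j \<Longrightarrow> x \<in> W i \<Longrightarrow> y \<in> W j \<Longrightarrow> \<phi> x y = 0"
    and exhaust: "\<And>v. \<exists>w. (\<forall>i\<in>I. w i \<in> W i) \<and> v = (\<Sum>i\<in>I. w i)"
  shows "orthogonal_direct_sum \<phi> I W"
proof -
  have component: "\<phi> (\<Sum>j\<in>I. w j) y = \<phi> (w i) y"
    if "\<And>j. j \<in> I \<Longrightarrow> w j \<in> W j" "i \<in> I" "y \<in> W i" for w i y
  proof -
    have "\<phi> (\<Sum>j\<in>I. w j) y = (\<Sum>j\<in>I. if j = i then \<phi> (w i) y else 0)"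
      unfolding phi_sum_left using that orth by (intro sum.cong) auto
    with assms(1) that(2) show ?thesis by simp
  qed
  have "\<exists>!w. w \<in> (\<Pi>\<^sub>E i\<in>I. W i) \<and> v = (\<Sum>i\<in>I. w i)" for v
  proof (rule ex_ex1I)
    obtain w where w: "\<forall>i\<in>I. w i \<in> W i" "v = (\<Sum>i\<in>I. w i)" using exhaust by blast
    have "v = (\<Sum>i\<in>I. restrict w I i)" unfolding w(2) by (intro sum.cong) auto
    with w(1) show "\<exists>w. w \<in> (\<Pi>\<^sub>E i\<in>I. W i) \<and> v = (\<Sum>i\<in>I. w i)"
      by (intro exI[of _ "restrict w I"]) auto
  next
    fix w w'
    assume w: "w \<in> (\<Pi>\<^sub>E i\<in>I. W i) \<and> v = (\<Sum>i\<in>I. w i)"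
      and w': "w' \<in> (\<Pi>\<^sub>E i\<in>I. W i) \<and> v = (\<Sum>i\<in>I. w' i)"
    show "w = w'"
    proof (rule PiE_ext)
      fix i assume i: "i \<in> I"
      have "\<phi> (w i - w' i) y = 0" if "y \<in> W i" for y
        using component[of w i y] component[of w' i y] w w' i that by (auto simp: PiE_mem)
      moreover have "w i - w' i \<in> W i"
        using w w' i W[OF i] by (auto simp: regular_subspace_def PiE_mem intro!: subspace_diff)
      ultimately have "w i - w' i \<in> W i \<inter> orth_complement \<phi> (W i)"
        by (simp add: orth_complement_def)
      with W[OF i] show "w i = w' i" by (simp add: regular_subspace_def)
    qed (use w w' in blast)+
  qed
  with assms show ?thesis by (auto simp: orthogonal_direct_sum_def regular_subspace_def)
qed

end

theorem theorem3p5: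
  fixes scale :: "'k::field \<Rightarrow> 'v::ab_group_add \<Rightarrow> 'v"
    and Basis :: "'v set"
    and \<phi> :: "'v \<Rightarrow> 'v \<Rightarrow> 'k"
    and \<delta> :: "'v \<Rightarrow> 'v"
    and k :: nat
  assumes "CHAR('k) \<noteq> 2"
    and "generalized_oscillator scale Basis \<phi> \<delta>"
    and "lie_algebra.nilpotent_of_index (osc_scale scale) (osc_bracket scale \<phi> \<delta>) k"
  shows "nilpotent_map \<delta> \<and>
    vector_space.minimal_polynomial scale \<delta> = monom 1 k \<and>
    (\<exists>(r::nat) (W :: nat \<Rightarrow> 'v set).
      vector_space.orthogonal_direct_sum scale \<phi> {..<r} W \<and>
      (\<forall>i<r.
        \<delta> ` W i \<subseteq> W i \<and>
        vector_space.regular_subspace scale \<phi> (W i) \<and>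
        ((\<exists>n. vector_space.dim scale (W i) = 2 * n + 1 \<and> n \<le> (k - 1) div 2 \<and>
            (\<exists>\<mu> bs. \<mu> \<noteq> 0 \<and> vector_space.ordered_basis scale bs (W i) \<and>
              vector_space.map_matrix scale \<delta> bs = odd_map_matrix n \<and>
              gram_matrix \<phi> bs = odd_form_matrix n \<mu>)) \<or>
         (\<exists>m\<ge>1. vector_space.dim scale (W i) = 4 * m \<and> m \<le> k div 2 \<and>
            (\<exists>bs. vector_space.ordered_basis scale bs (W i) \<and>
              vector_space.map_matrix scale \<delta> bs = even_map_matrix m \<and>
              gram_matrix \<phi> bs = even_form_matrix m)))))"
proof -
  interpret generalized_oscillator scale Basis \<phi> \<delta> by (rule assms(2))
  interpret L: lie_algebra "osc_scale scale" "osc_bracket scale \<phi> \<delta>"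
    using assms(1) by (rule osc_lie_algebra)
  have two: "(2::'k) \<noteq> 0"
  proof
    assume "(2::'k) = 0"
    then have "of_nat 2 = (0::'k)" by simp
    then have "CHAR('k) dvd 2" by (simp only: of_nat_eq_0_iff_char_dvd)
    with assms(1) show False by (metis CHAR_not_1 One_nat_def prime_nat_iff two_is_prime_nat)
  qed
  from assms(3) obtain j where j: "k = Suc j" "L.lower_central_series (Suc j) \<noteq> {0}"
      "L.lower_central_series (Suc k) = {0}"
    by (cases k) (auto simp: L.nilpotent_of_index_def)
  have nil: "\<delta> ^^ k = (\<lambda>_. 0)" and last: "\<delta> ^^ j \<noteq> (\<lambda>_. 0)"
    using j(2,3) lower_central_series_zero_iff[OF assms(1)] by blast+
  have "\<delta> ^^ i \<noteq> (\<lambda>_. 0)" if "i < k" for i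
  proof
    assume "\<delta> ^^ i = (\<lambda>_. 0)"
    then have "(\<delta> ^^ j) x = 0" for x
      using delta_pow_vanish[of i x j] that j(1) by (simp add: fun_eq_iff)
    with last show False by (auto simp: fun_eq_iff)
  qed
  with nil have minpoly: "minimal_polynomial \<delta> = monom 1 k"
    by (intro minimal_polynomial_nilpotent[OF linear_delta])
  have "regular_subspace \<phi> UNIV"
    using form(2) by (auto simp: regular_subspace_def orth_complement_def nondegenerate_def)
  then obtain r W where W: "\<forall>i<(r::nat). standard_block k (W i)"
      "\<forall>i<r. \<forall>j<r. i \<noteq> j \<longrightarrow> (\<forall>x\<in>W i. \<forall>y\<in>W j. \<phi> x y = 0)"
      "\<And>u. \<exists>w. (\<forall>i<r. w i \<in> W i) \<and> u = (\<Sum>i<r. w i)"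
    using orthogonal_block_decomposition[OF two nil, of UNIV] by auto
  have "orthogonal_direct_sum \<phi> {..<r} W"
  proof (rule orthogonal_regular_sum_direct)
    show "\<exists>w. (\<forall>i\<in>{..<r}. w i \<in> W i) \<and> v = (\<Sum>i<r. w i)" for v
      using W(3)[of v] by (simp only: Ball_def lessThan_iff)
  qed (use W(1,2) in \<open>auto simp: standard_block_def\<close>)
  moreover have "nilpotent_map \<delta>" using nil by (auto simp: nilpotent_map_def)
  ultimately show ?thesis
    using minpoly W(1) unfolding standard_block_def by blast
qed

end
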